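(* Let $w$ be the solution of $$w_t+a(x,t)w_x=f(x),\ (x,t)\in\Omega;\qquad w(0,t)=0,\qquad w(x,0)=\int_0^x\frac{f(s)}{a(s,0)}\,ds,$$ where $\Omega=(0,L]\times(0,T]$ and $a,f$ satisfy the conditions in the context. Let $W$ be the solution of the upwind scheme $$\bigl(D_t^-+a(x_i,t_j)D_x^-\bigr)W(x_i,t_j)=f(x_i),\quad 1\le i\le N,\ 1\le j\le M,$$ $$W(0,t_j)=0,\ t_j\ge0;\qquad a(x_i,0)D_x^-W(x_i,0)=f(x_i),\ x_i>0,$$ on the mesh $\Omega_{SU}^N$ defined in the context, and let $\bar W$ be the piecewise bilinear interpolant of $W$ on $\bar\Omega$. Then there is a constant $C$, independent of $\varepsilon$, $N$ and $M$, such that $$\|\bar W-w\|\le CN^{-1}(\ln N)^2+CM^{-1}.$$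
   Context: $L,T>0$, $0<\varepsilon\le1$, $\bar\Omega=[0,L]\times[0,T]$; $\|\cdot\|$ is the $L_\infty$ norm on $\bar\Omega$. $N$ is an even positive integer and $M$ a positive integer. The function $w$ is the boundary layer component of the solution $u$ of $u_t+a u_x+bu=f$ in $\Omega$, $u(0,t)=\psi(t)$, $u(x,0)=\phi(x)$ with $b\equiv0$. Assumptions: $a\in C^3(\bar\Omega)$ is independent of $\varepsilon$, $a(x,t)\ge\alpha>0$ on $\bar\Omega$, $a_t(0,0)=0$; $f=f(x)$ depends only on $x$ (and on $\varepsilon$), is $C^2$, and satisfies, with a constant independent of $\varepsilon$, $$\left|\frac{\partial^{i+j}f}{\partial x^i\partial t^j}(x,t)\right|\le Cx^{2-i}\varepsilon^{i-3}e^{-\frac{x}{\varepsilon}},\quad 0\le i+j\le2.$$ (In particular $f(0)=f'(0)=0$.) The data $\psi\in C^2([0,T])$, $\phi\in C^2([0,L])$ are independent of $\varepsilon$ and satisfy the compatibility conditions $$\phi(0)=\psi(0),\qquad \psi'(0)+a(0,0)\phi'(0)=f(0),$$ $$-\psi''(0)+\phi'(0)[a(0,0)a_x(0,0)-a_t(0,0)]+a^2(0,0)\phi''(0)=a(0,0)f'(0).$$ They do not enter the problem for $w$. Mesh $\Omega_{SU}^N$: put $\sigma=\min\{L/2,\varepsilon\ln N\}$; each of $[0,\sigma]$ and $[\sigma,L]$ is divided into $N/2$ equal subintervals, giving $0=x_0<\dots<x_N=L$; the time mesh is uniform, $t_j=jT/M$, $0\le j\le M$. The mesh is the tensor product. With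 $h_i=x_i-x_{i-1}$, $k_j=t_j-t_{j-1}$, $$D_t^-Y(x_i,t_j)=\frac{Y(x_i,t_j)-Y(x_i,t_{j-1})}{k_j},\quad D_x^-Y(x_i,t_j)=\frac{Y(x_i,t_j)-Y(x_{i-1},t_j)}{h_i}.$$ $\bar W$ is the function on $\bar\Omega$ that is bilinear on each mesh cell $[x_{i-1},x_i]\times[t_{j-1},t_j]$ and equals $W$ at all mesh points. *)

theory Defs
  imports "HOL-Analysis.Analysis"
begin

text \<open>
  Functions on the closed rectangle \<open>[0,L] \<times> [0,T]\<close> are curried, \<open>g x t\<close>. Partial derivatives
  are taken within the rectangle, hence are one-sided on its boundary.
\<close>

definition has_partials ::
  "real \<Rightarrow> real \<Rightarrow> (real \<Rightarrow> real \<Rightarrow> real) \<Rightarrow> (real \<Rightarrow> real \<Rightarrow> real) \<Rightarrow> (real \<Rightarrow> real \<Rightarrow> real) \<Rightarrow> bool"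
where
  "has_partials L T g gx gt \<longleftrightarrow>
     (\<forall>x\<in>{0..L}. \<forall>t\<in>{0..T}.
        ((\<lambda>y. g y t) has_real_derivative gx x t) (at x within {0..L}) \<and>
        ((\<lambda>s. g x s) has_real_derivative gt x t) (at t within {0..T}))"

text \<open>\<open>g \<in> C\<^sup>k([0,L] \<times> [0,T])\<close>: all (also mixed) partial derivatives up to order \<open>k\<close> exist and are
  continuous on the closed rectangle.\<close>

fun Ck_rect :: "nat \<Rightarrow> real \<Rightarrow> real \<Rightarrow> (real \<Rightarrow> real \<Rightarrow> real) \<Rightarrow> bool" where
  "Ck_rect 0 L T g \<longleftrightarrow> continuous_on ({0..L} \<times> {0..T}) (\<lambda>(x, t). g x t)"
| "Ck_rect (Suc k) L T g \<longleftrightarrow>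
     continuous_on ({0..L} \<times> {0..T}) (\<lambda>(x, t). g x t) \<and>
     (\<exists>gx gt. has_partials L T g gx gt \<and> Ck_rect k L T gx \<and> Ck_rect k L T gt)"

text \<open>
  The source \<open>f \<in> C\<^sup>2([0,L])\<close> with \<open>\<bar>f\<^bsup>(i)\<^esup>(x)\<bar> \<le> K x\<^bsup>2-i\<^esup> \<epsilon>\<^bsup>i-3\<^esup> exp (-x/\<epsilon>)\<close>. As \<open>f\<close> does not depend
  on \<open>t\<close>, its \<open>t\<close>-derivatives vanish and satisfy the corresponding bounds trivially.
\<close>

definition layer_source :: "real \<Rightarrow> real \<Rightarrow> real \<Rightarrow> (real \<Rightarrow> real) \<Rightarrow> bool" where
  "layer_source L K \<epsilon> f \<longleftrightarrow>
     (\<exists>d :: nat \<Rightarrow> real \<Rightarrow> real.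
        d 0 = f \<and>
        (\<forall>i<2. \<forall>x\<in>{0..L}. (d i has_real_derivative d (Suc i) x) (at x within {0..L})) \<and>
        continuous_on {0..L} (d 2) \<and>
        (\<forall>i\<le>2. \<forall>x\<in>{0..L}.
           \<bar>d i x\<bar> \<le> K * x ^ (2 - i) * \<epsilon> powi (int i - 3) * exp (- x / \<epsilon>)))"

text \<open>Classical (\<open>C\<^sup>1\<close> up to the boundary) solution of the problem for the layer component.\<close>

definition layer_solution ::
  "real \<Rightarrow> real \<Rightarrow> (real \<Rightarrow> real \<Rightarrow> real) \<Rightarrow> (real \<Rightarrow> real) \<Rightarrow> (real \<Rightarrow> real \<Rightarrow> real) \<Rightarrow> bool"
where
  "layer_solution L T a f w \<longleftrightarrow>
     Ck_rect 1 L T w \<and>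
     (\<exists>wx wt. has_partials L T w wx wt \<and>
        (\<forall>x\<in>{0<..L}. \<forall>t\<in>{0<..T}. wt x t + a x t * wx x t = f x)) \<and>
     (\<forall>t\<in>{0..T}. w 0 t = 0) \<and>
     (\<forall>x\<in>{0..L}. w x 0 = integral {0..x} (\<lambda>s. f s / a s 0))"

definition transition_point :: "real \<Rightarrow> real \<Rightarrow> nat \<Rightarrow> real" where
  "transition_point L \<epsilon> N = min (L / 2) (\<epsilon> * ln (real N))"

definition mesh_x :: "real \<Rightarrow> real \<Rightarrow> nat \<Rightarrow> nat \<Rightarrow> real" where
  "mesh_x L \<epsilon> N i =
     (let \<sigma> = transition_point L \<epsilon> N in
      if i \<le> N div 2 then real i * (\<sigma> / (real N / 2))
      else \<sigma> + (real i - real N / 2) * ((L - \<sigma>) / (real N / 2)))"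

definition mesh_t :: "real \<Rightarrow> nat \<Rightarrow> nat \<Rightarrow> real" where
  "mesh_t T M j = real j * T / real M"

text \<open>Backward differences of a grid function \<open>W i j\<close> on a tensor product mesh with nodes
  \<open>(X i, \<tau> j)\<close>; they are only used for \<open>i \<ge> 1\<close>, respectively \<open>j \<ge> 1\<close>.\<close>

definition Dx_minus :: "(nat \<Rightarrow> real) \<Rightarrow> (nat \<Rightarrow> nat \<Rightarrow> real) \<Rightarrow> nat \<Rightarrow> nat \<Rightarrow> real" where
  "Dx_minus X W i j = (W i j - W (i - 1) j) / (X i - X (i - 1))"

definition Dt_minus :: "(nat \<Rightarrow> real) \<Rightarrow> (nat \<Rightarrow> nat \<Rightarrow> real) \<Rightarrow> nat \<Rightarrow> nat \<Rightarrow> real" where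
  "Dt_minus \<tau> W i j = (W i j - W i (j - 1)) / (\<tau> j - \<tau> (j - 1))"

definition upwind_solution ::
  "(nat \<Rightarrow> real) \<Rightarrow> (nat \<Rightarrow> real) \<Rightarrow> nat \<Rightarrow> nat \<Rightarrow> (real \<Rightarrow> real \<Rightarrow> real) \<Rightarrow> (real \<Rightarrow> real)
     \<Rightarrow> (nat \<Rightarrow> nat \<Rightarrow> real) \<Rightarrow> bool"
where
  "upwind_solution X \<tau> N M a f W \<longleftrightarrow>
     (\<forall>i\<in>{1..N}. \<forall>j\<in>{1..M}.
        Dt_minus \<tau> W i j + a (X i) (\<tau> j) * Dx_minus X W i j = f (X i)) \<and>
     (\<forall>j\<in>{0..M}. W 0 j = 0) \<and>
     (\<forall>i\<in>{1..N}. a (X i) 0 * Dx_minus X W i 0 = f (X i))"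

definition bilinear_interpolant ::
  "(nat \<Rightarrow> real) \<Rightarrow> (nat \<Rightarrow> real) \<Rightarrow> nat \<Rightarrow> nat \<Rightarrow> (nat \<Rightarrow> nat \<Rightarrow> real) \<Rightarrow> (real \<Rightarrow> real \<Rightarrow> real) \<Rightarrow> bool"
where
  "bilinear_interpolant X \<tau> N M W g \<longleftrightarrow>
     (\<forall>i\<in>{1..N}. \<forall>j\<in>{1..M}. \<exists>c0 c1 c2 c3.
        \<forall>x\<in>{X (i - 1)..X i}. \<forall>t\<in>{\<tau> (j - 1)..\<tau> j}. g x t = c0 + c1 * x + c2 * t + c3 * x * t) \<and>
     (\<forall>i\<in>{0..N}. \<forall>j\<in>{0..M}. g (X i) (\<tau> j) = W i j)"

text \<open>The \<open>L\<^sub>\<infinity>\<close> norm on the rectangle. It is only applied to continuous functions, for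
  which it is the supremum of the (bounded) set of absolute values.\<close>

definition linf_norm :: "real \<Rightarrow> real \<Rightarrow> (real \<Rightarrow> real \<Rightarrow> real) \<Rightarrow> real" where
  "linf_norm L T g = (SUP (x, t)\<in>{0..L} \<times> {0..T}. \<bar>g x t\<bar>)"

end

theory Submission imports Defs
begin

text \<open>
  Derivatives of \<open>w\<close> are hard to reach, because \<open>w\<close> is only known to be
  \<open>C\<^sup>1\<close> and its higher derivatives would have to be followed along characteristics. The proof
  therefore does not insert \<open>w\<close> into the scheme. It inserts the interpolant of the discrete solution
  \<open>W\<close> into the differential equation, so that regularity is needed for \<open>W\<close> only, where it means
  bounds for difference quotients, and these follow from an elementary induction over the grid.

  The bound \<open>K x\<^sup>2 \<epsilon>\<^sup>-\<^sup>3 e\<^bsup>-x/\<epsilon>\<^esup>\<close> for the source is of order \<open>1/\<epsilon>\<close> at \<open>x = 2\<epsilon>\<close>, so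
  it gives no pointwise bound for \<open>D\<^sub>xW\<close> that is uniform in \<open>\<epsilon>\<close>. Its integral, however, is bounded.
  The estimates are therefore measured against the weight
  \<open>\<Phi>(x) = (y\<^sup>2 + 2y + 2) e\<^bsup>-y\<^esup> / \<epsilon>\<close> with \<open>y = x/\<epsilon>\<close> (\<open>layer_weight\<close>). It dominates
  the source up to the factor \<open>K\<close>, it is decreasing, and it has mass \<open>6\<close> for
  every \<open>\<epsilon>\<close>. Since the speed is at least \<open>\<alpha>\<close>, a particle crosses the layer quickly, and a right-hand side \<open>p(x)\<close> costs only
  \<open>\<alpha>\<^sup>-\<^sup>1 \<integral> p\<close>. This is the content of both comparison principles (\<open>discrete_comparison\<close>,
  \<open>transport_comparison\<close>).

  For the discrete regularity put \<open>Z = D\<^sub>tW\<close>. The data at \<open>t = 0\<close> solve the stationary scheme, so \<open>Z\<close>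
  vanishes there, and differencing the scheme in time gives
  \<open>(D\<^sub>t + a D\<^sub>x) Z = - (D\<^sub>ta) D\<^sub>xW\<close>, where the scheme itself expresses \<open>D\<^sub>xW\<close> by \<open>f\<close> and \<open>Z\<close>. As
  \<open>f\<close> has bounded mass, \<open>Z\<close> is bounded (\<open>DtW_le\<close>). Differencing once more bounds \<open>D\<^sub>tZ\<close>
  (\<open>DttW_le\<close>), provided it is bounded on the first time level. There
  \<open>D\<^sub>ta D\<^sub>xW\<close> is at most a constant times \<open>(x + k) \<bar>f(x)\<bar>\<close> because \<open>a\<^sub>t(0,0) = 0\<close>;
  the part \<open>x \<bar>f(x)\<bar>\<close> is bounded and the part \<open>k \<bar>f(x)\<bar>\<close> has mass \<open>O(k)\<close> (\<open>DttW_first_level\<close>). The two difference equations then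
  give \<open>\<bar>D\<^sub>xW\<bar> + \<bar>D\<^sub>xD\<^sub>tW\<bar> \<le> C (1 + \<Phi>)\<close> (\<open>slopes_le\<close>).

  On a cell the bilinear interpolant has \<open>D\<^sub>xD\<^sub>tW\<close> as its mixed derivative, so its residual
  in the differential equation is at most \<open>C (h + k) (1 + \<Phi>(x)) + \<bar>f(x) - f(x\<^sub>i)\<bar>\<close>
  (\<open>interpolant_residual\<close>). Where the mesh is fine, \<open>h \<le> 2 \<epsilon> N\<^sup>-\<^sup>1 ln N\<close> and the difference of the
  source values is at most \<open>C N\<^sup>-\<^sup>1 ln N \<Phi>(x)\<close>. Beyond \<open>x = \<epsilon> ln N\<close> it is bounded by the source
  values themselves, hence by \<open>2 K \<Phi>(x)\<close>, and the mass of \<open>\<Phi>\<close> beyond that point is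
  \<open>((ln N)\<^sup>2 + 4 ln N + 6) / N\<close>. This tail produces the factor \<open>(ln N)\<^sup>2\<close> in the theorem. Integrating
  these residual bounds with the continuous comparison principle gives \<open>error_estimate\<close>.
\<close>

section \<open>The layer weight and its antiderivative\<close>

text \<open>
  The polynomial factor is chosen such that the weight dominates the profile
  \<open>x\<^sup>2 \<epsilon>\<^sup>-\<^sup>3 e\<^bsup>-x/\<epsilon>\<^esup>\<close> of the source and is nevertheless decreasing; the profile itself
  increases up to \<open>x = 2\<epsilon>\<close>. Monotonicity lets a value at the right end of a cell be
  estimated by the value, or the integral, over the whole cell.
\<close>

definition layer_weight :: "real \<Rightarrow> real \<Rightarrow> real" where
  "layer_weight \<epsilon> x = ((x / \<epsilon>)\<^sup>2 + 2 * (x / \<epsilon>) + 2) * exp (- (x / \<epsilon>)) / \<epsilon>"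

text \<open>
  The integral of the weight over \<open>[0,x]\<close>, in closed form; \<open>6\<close> is the total mass.
\<close>

definition layer_mass :: "real \<Rightarrow> real \<Rightarrow> real" where
  "layer_mass \<epsilon> x = 6 - ((x / \<epsilon>)\<^sup>2 + 4 * (x / \<epsilon>) + 6) * exp (- (x / \<epsilon>))"

lemma layer_mass_deriv:
  assumes "\<epsilon> > 0"
  shows "(layer_mass \<epsilon> has_real_derivative layer_weight \<epsilon> x) (at x within S)"
  unfolding layer_mass_def [abs_def] layer_weight_def
  using assms
  by (auto intro!: derivative_eq_intros simp: field_simps power2_eq_square)

lemma layer_weight_nonneg: "\<epsilon> > 0 \<Longrightarrow> x \<ge> 0 \<Longrightarrow> layer_weight \<epsilon> x \<ge> 0"
  by (simp add: layer_weight_def)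

lemma layer_weight_antimono:
  assumes "\<epsilon> > 0" "0 \<le> x" "x \<le> y"
  shows "layer_weight \<epsilon> y \<le> layer_weight \<epsilon> x"
proof (rule DERIV_nonpos_imp_nonincreasing[OF \<open>x \<le> y\<close>])
  fix z assume "x \<le> z" "z \<le> y"
  have "(layer_weight \<epsilon> has_real_derivative - ((z / \<epsilon>)\<^sup>2 * exp (- (z / \<epsilon>)) / \<epsilon>\<^sup>2)) (at z)"
    unfolding layer_weight_def [abs_def] using assms
    by (auto intro!: derivative_eq_intros simp: field_simps power2_eq_square)
  then show "\<exists>d. (layer_weight \<epsilon> has_real_derivative d) (at z) \<and> d \<le> 0"
    by (meson divide_nonneg_nonneg exp_ge_zero mult_nonneg_nonneg neg_le_0_iff_le zero_le_power2)
qed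

lemma layer_mass_0: "layer_mass \<epsilon> 0 = 0"
  by (simp add: layer_mass_def)

lemma layer_mass_le: "\<epsilon> > 0 \<Longrightarrow> x \<ge> 0 \<Longrightarrow> layer_mass \<epsilon> x \<le> 6"
  by (simp add: layer_mass_def)

text \<open>
  Right-endpoint Riemann sums of the weight telescope, on any mesh.
\<close>

lemma layer_weight_cell:
  assumes "\<epsilon> > 0" "0 \<le> x" "x < y"
  shows "(y - x) * layer_weight \<epsilon> y \<le> layer_mass \<epsilon> y - layer_mass \<epsilon> x"
proof -
  obtain z where z: "x < z" "z < y"
    "layer_mass \<epsilon> y - layer_mass \<epsilon> x = (y - x) * layer_weight \<epsilon> z"
    using MVT2[OF \<open>x < y\<close>, of "layer_mass \<epsilon>" "layer_weight \<epsilon>"] layer_mass_deriv[OF \<open>\<epsilon> > 0\<close>]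
    by blast
  show ?thesis
    using layer_weight_antimono[of \<epsilon> z y] z assms by (simp add: mult_left_mono)
qed

lemma layer_profile_le:
  assumes "\<epsilon> > 0" "x \<ge> 0"
  shows "x\<^sup>2 / \<epsilon> ^ 3 * exp (- (x / \<epsilon>)) \<le> layer_weight \<epsilon> x"
proof -
  have "x\<^sup>2 / \<epsilon> ^ 3 * exp (- (x / \<epsilon>)) = (x / \<epsilon>)\<^sup>2 * exp (- (x / \<epsilon>)) / \<epsilon>"
    by (simp add: power_divide power3_eq_cube power2_eq_square)
  also have "\<dots> \<le> layer_weight \<epsilon> x"
    unfolding layer_weight_def using assms
    by (intro divide_right_mono mult_right_mono) auto
  finally show ?thesis .
qed

text \<open>
  In the variable \<open>y = x/\<epsilon>\<close> this is \<open>y\<^sup>3 \<le> 27 e\<^sup>y\<close>, the cube of \<open>y/3 \<le> e\<^bsup>y/3\<^esup>\<close>. One extra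
  factor \<open>x\<close> thus turns the profile, whose peak is of order \<open>1/\<epsilon>\<close>, into a bounded function.
\<close>

lemma layer_profile_moment:
  fixes \<epsilon> x :: real
  assumes "\<epsilon> > 0" "x \<ge> 0"
  shows "x * (x\<^sup>2 / \<epsilon> ^ 3 * exp (- (x / \<epsilon>))) \<le> 27"
proof -
  define y where "y = x / \<epsilon>"
  have "y / 3 \<le> exp (y / 3)" using exp_ge_add_one_self[of "y / 3"] by linarith
  then have "(y / 3) ^ 3 \<le> exp (y / 3) ^ 3"
    using assms by (intro power_mono) (auto simp: y_def)
  also have "\<dots> = exp y" by (simp flip: exp_of_nat_mult)
  finally have "y ^ 3 * exp (- y) \<le> 27"
    by (simp add: exp_minus field_simps)
  moreover have "x * (x\<^sup>2 / \<epsilon> ^ 3 * exp (- (x / \<epsilon>))) = y ^ 3 * exp (- y)"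
    by (simp add: y_def power_divide power3_eq_cube power2_eq_square)
  ultimately show ?thesis by simp
qed

lemma layer_profile_slope_le:
  fixes \<epsilon> x :: real
  assumes "0 < \<epsilon>" "\<epsilon> \<le> 1" "0 \<le> x"
  shows "x / \<epsilon>\<^sup>2 * exp (- (x / \<epsilon>)) \<le> layer_weight \<epsilon> x / \<epsilon>"
proof -
  have "0 \<le> x / \<epsilon>" using assms by simp
  then have y: "x / \<epsilon> \<le> (x / \<epsilon>)\<^sup>2 + 2 * (x / \<epsilon>) + 2"
    using zero_le_power2[of "x / \<epsilon>"] by linarith
  have "x / \<epsilon>\<^sup>2 * exp (- (x / \<epsilon>)) = (x / \<epsilon>) * exp (- (x / \<epsilon>)) / \<epsilon>"
    by (simp add: power2_eq_square)
  also have "\<dots> \<le> layer_weight \<epsilon> x"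
    unfolding layer_weight_def using assms y by (intro divide_right_mono mult_right_mono) auto
  also have "\<dots> \<le> layer_weight \<epsilon> x / \<epsilon>"
    using assms layer_weight_nonneg[of \<epsilon> x] mult_left_le[of \<epsilon> "layer_weight \<epsilon> x"]
    by (simp add: le_divide_eq)
  finally show ?thesis .
qed

text \<open>
  The form in which the source enters the error analysis: \<open>f\<close> is dominated by the weight, and
  differentiation costs a factor \<open>1/\<epsilon>\<close>.
\<close>

lemma layer_source_bounds:
  assumes src: "layer_source L K \<epsilon> f" and "0 < L" "0 < \<epsilon>" "\<epsilon> \<le> 1"
  obtains f' where "0 \<le> K"
    "\<forall>x\<in>{0..L}. \<bar>f x\<bar> \<le> K * (x\<^sup>2 / \<epsilon> ^ 3 * exp (- (x / \<epsilon>)))"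
    "\<forall>x\<in>{0..L}. (f has_real_derivative f' x) (at x within {0..L})"
    "\<forall>x\<in>{0..L}. \<bar>f' x\<bar> \<le> K / \<epsilon> * layer_weight \<epsilon> x"
proof -
  obtain d :: "nat \<Rightarrow> real \<Rightarrow> real" where d0: "d 0 = f"
    and dd: "\<forall>i<2. \<forall>x\<in>{0..L}. (d i has_real_derivative d (Suc i) x) (at x within {0..L})"
    and db: "\<forall>i\<le>2. \<forall>x\<in>{0..L}.
      \<bar>d i x\<bar> \<le> K * x ^ (2 - i) * \<epsilon> powi (int i - 3) * exp (- x / \<epsilon>)"
    using src unfolding layer_source_def by blast
  have b0: "\<bar>f x\<bar> \<le> K * (x\<^sup>2 / \<epsilon> ^ 3 * exp (- (x / \<epsilon>)))" if "x \<in> {0..L}" for x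
    using db[rule_format, of 0 x] that
    by (simp add: d0 power_int_minus power_int_numeral divide_inverse mult_ac)
  have b1: "\<bar>d 1 x\<bar> \<le> K * (x / \<epsilon>\<^sup>2 * exp (- (x / \<epsilon>)))" if "x \<in> {0..L}" for x
    using db[rule_format, of 1 x] that
    by (simp add: power_int_minus power_int_numeral divide_inverse mult_ac)
  have K: "0 \<le> K"
  proof (rule ccontr)
    assume "\<not> 0 \<le> K"
    then have "K * (L\<^sup>2 / \<epsilon> ^ 3 * exp (- (L / \<epsilon>))) < 0"
      using \<open>0 < L\<close> \<open>0 < \<epsilon>\<close> by (intro mult_neg_pos) auto
    then show False using b0[of L] \<open>0 < L\<close> by simp
  qed
  show ?thesis
  proof (rule that)
    show "\<forall>x\<in>{0..L}. (f has_real_derivative d 1 x) (at x within {0..L})"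
      using dd[rule_format, of 0] d0 by simp
    show "\<forall>x\<in>{0..L}. \<bar>d 1 x\<bar> \<le> K / \<epsilon> * layer_weight \<epsilon> x"
    proof
      fix x assume x: "x \<in> {0..L}"
      have "\<bar>d 1 x\<bar> \<le> K * (layer_weight \<epsilon> x / \<epsilon>)"
        using b1[OF x] mult_left_mono[OF layer_profile_slope_le[of \<epsilon> x] K] x assms(3,4) by force
      then show "\<bar>d 1 x\<bar> \<le> K / \<epsilon> * layer_weight \<epsilon> x" by simp
    qed
  qed (use K b0 in auto)
qed

section \<open>Comparison principle for the upwind operator\<close>

text \<open>
  The upwind equation makes \<open>y\<close>, up to the right-hand side, the average of its neighbours \<open>y0\<close> in
  time and \<open>y1\<close> in space with weights proportional to \<open>1/k\<close> and \<open>c/h\<close>. The right-hand side may be split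
  freely: a part \<open>g\<close> charged to the time step raises \<open>y0\<close> by \<open>k g\<close>, and a part \<open>p\<close> charged to
  the space step raises \<open>y1\<close> by at most \<open>h p / \<alpha>\<close>.
\<close>

lemma upwind_step:
  fixes y y0 y1 c h k \<alpha> g p R :: real
  assumes "0 < h" "0 < k" "0 < \<alpha>" "\<alpha> \<le> c" "0 \<le> p"
    and eq: "\<bar>(y - y0) / k + c * ((y - y1) / h)\<bar> \<le> g + p"
    and t: "\<bar>y0\<bar> + k * g \<le> R" and x: "\<bar>y1\<bar> + h * p / \<alpha> \<le> R"
  shows "\<bar>y\<bar> \<le> R"
proof -
  have c: "c > 0" using assms by linarith
  define r where "r = (y - y0) / k + c * ((y - y1) / h)"
  have "(1 / k + c / h) * y = r + y0 / k + c / h * y1"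
    unfolding r_def using assms by (simp add: field_simps)
  then have "(1 / k + c / h) * \<bar>y\<bar> = \<bar>r + y0 / k + c / h * y1\<bar>"
    using assms c by (metis abs_mult abs_of_pos add_pos_pos divide_pos_pos zero_less_one)
  also have "\<dots> \<le> \<bar>r\<bar> + \<bar>y0\<bar> / k + c / h * \<bar>y1\<bar>"
    using assms c abs_triangle_ineq[of "r + y0 / k" "c / h * y1"] abs_triangle_ineq[of r "y0 / k"]
    by (simp add: abs_mult)
  also have "\<dots> \<le> (g + p) + \<bar>y0\<bar> / k + c / h * \<bar>y1\<bar>"
    using eq by (simp add: r_def)
  also have "\<dots> = (\<bar>y0\<bar> + k * g) / k + (c / h * \<bar>y1\<bar> + p)"
    using assms by (simp add: field_simps)
  also have "\<dots> \<le> R / k + c / h * R"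
  proof (rule add_mono)
    show "(\<bar>y0\<bar> + k * g) / k \<le> R / k" using t assms by (simp add: divide_right_mono)
    have "p \<le> c / h * (h * p / \<alpha>)"
      using assms by (simp add: field_simps mult_right_mono)
    then have "c / h * \<bar>y1\<bar> + p \<le> c / h * (\<bar>y1\<bar> + h * p / \<alpha>)"
      by (simp add: distrib_left)
    also have "\<dots> \<le> c / h * R" using x assms c by (intro mult_left_mono) auto
    finally show "c / h * \<bar>y1\<bar> + p \<le> c / h * R" .
  qed
  finally have "(1 / k + c / h) * \<bar>y\<bar> \<le> (1 / k + c / h) * R" by (simp add: algebra_simps)
  moreover have "1 / k + c / h > 0" using assms c by (simp add: add_pos_pos)
  ultimately show ?thesis by (metis mult_le_cancel_left_pos)
qed

text \<open>
  A right-hand side \<open>p\<close> accumulates along the space direction to \<open>\<alpha>\<^sup>-\<^sup>1 \<Sum> h p\<close>, uniformly in the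
  number of time steps, whereas the feedback \<open>B \<bar>Y i (j - 1)\<bar>\<close> from the previous time level causes
  growth by the factor \<open>1 + B k\<close> in each time step.
\<close>

lemma discrete_comparison:
  fixes X \<tau> :: "nat \<Rightarrow> real" and Y c :: "nat \<Rightarrow> nat \<Rightarrow> real"
  assumes X: "\<And>i. i \<in> {1..N} \<Longrightarrow> X (i - 1) < X i"
    and \<tau>: "\<And>j. j \<in> {m<..M} \<Longrightarrow> \<tau> j - \<tau> (j - 1) = k" and "0 < k"
    and c: "\<And>i j. i \<in> {1..N} \<Longrightarrow> j \<in> {m<..M} \<Longrightarrow> \<alpha> \<le> c i j" and "0 < \<alpha>"
    and "0 \<le> B" and "0 \<le> q" and p: "\<And>i. i \<in> {1..N} \<Longrightarrow> 0 \<le> p i"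
    and left: "\<And>j. j \<in> {m..M} \<Longrightarrow> \<bar>Y 0 j\<bar> \<le> q"
    and init: "\<And>i. i \<in> {0..N} \<Longrightarrow> \<bar>Y i m\<bar> \<le> q"
    and op: "\<And>i j. i \<in> {1..N} \<Longrightarrow> j \<in> {m<..M} \<Longrightarrow>
       \<bar>Dt_minus \<tau> Y i j + c i j * Dx_minus X Y i j\<bar> \<le> p i + B * \<bar>Y i (j - 1)\<bar>"
    and "i \<le> N" "m \<le> j" "j \<le> M"
  shows "\<bar>Y i j\<bar> \<le> (q + (\<Sum>l=1..i. (X l - X (l - 1)) * p l) / \<alpha>) * (1 + B * k) ^ (j - m)"
proof -
  define Q where "Q i = q + (\<Sum>l=1..i. (X l - X (l - 1)) * p l) / \<alpha>" for i
  define E where "E j = (1 + B * k) ^ (j - m)" for j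
  have E1: "E j \<ge> 1" for j unfolding E_def using \<open>0 \<le> B\<close> \<open>0 < k\<close> by (simp add: one_le_power)
  have Qq: "Q i \<ge> q" if "i \<le> N" for i
    unfolding Q_def using that X p \<open>0 < \<alpha>\<close>
    by (auto intro!: divide_nonneg_pos sum_nonneg mult_nonneg_nonneg simp: less_imp_le)
  have qE: "q \<le> Q i * E j" if "i \<le> N" for i j
    using mult_mono[OF Qq[OF that] E1[of j]] \<open>0 \<le> q\<close> Qq[OF that] by simp
  have "\<bar>Y i j\<bar> \<le> Q i * E j"
    using \<open>m \<le> j\<close> \<open>j \<le> M\<close> \<open>i \<le> N\<close>
  proof (induction j arbitrary: i rule: dec_induct)
    case base
    then show ?case using init[of i] qE[of i m] by force
  next
    case (step j)
    note time_IH = step.IH and j = step.hyps step.prems(1)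
    show ?case using \<open>i \<le> N\<close>
    \<comment> \<open>Within one time level the estimate is carried from cell to cell in the direction of transport.\<close>
    proof (induction i)
      case 0
      then show ?case using left[of "Suc j"] qE[of 0 "Suc j"] j by force
    next
      case (Suc i)
      have E_Suc: "E (Suc j) = (1 + B * k) * E j" using j by (simp add: E_def Suc_diff_le)
      have Q_Suc: "Q (Suc i) = Q i + (X (Suc i) - X i) * p (Suc i) / \<alpha>"
        by (simp add: Q_def add_divide_distrib)
      have h: "X i < X (Suc i)" and p0: "0 \<le> p (Suc i)" using X[of "Suc i"] p[of "Suc i"] Suc.prems by auto
      show ?case
      proof (rule upwind_step)
        show "0 < X (Suc i) - X i" "0 < k" "0 < \<alpha>" "\<alpha> \<le> c (Suc i) (Suc j)" "0 \<le> p (Suc i)"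
          using h p0 \<open>0 < k\<close> \<open>0 < \<alpha>\<close> c[of "Suc i" "Suc j"] Suc.prems j by auto
        show "\<bar>(Y (Suc i) (Suc j) - Y (Suc i) j) / k
            + c (Suc i) (Suc j) * ((Y (Suc i) (Suc j) - Y i (Suc j)) / (X (Suc i) - X i))\<bar>
          \<le> B * \<bar>Y (Suc i) j\<bar> + p (Suc i)"
          using op[of "Suc i" "Suc j"] \<tau>[of "Suc j"] Suc.prems j
          by (simp add: Dt_minus_def Dx_minus_def add.commute)
        have "\<bar>Y (Suc i) j\<bar> + k * (B * \<bar>Y (Suc i) j\<bar>) = (1 + B * k) * \<bar>Y (Suc i) j\<bar>"
          by (simp add: algebra_simps)
        also have "\<dots> \<le> (1 + B * k) * (Q (Suc i) * E j)"
          using time_IH[of "Suc i"] Suc.prems j \<open>0 \<le> B\<close> \<open>0 < k\<close> by (intro mult_left_mono) auto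
        finally show "\<bar>Y (Suc i) j\<bar> + k * (B * \<bar>Y (Suc i) j\<bar>) \<le> Q (Suc i) * E (Suc j)"
          by (simp add: E_Suc algebra_simps)
        have "(X (Suc i) - X i) * p (Suc i) / \<alpha> * 1 \<le> (X (Suc i) - X i) * p (Suc i) / \<alpha> * E (Suc j)"
          using h p0 E1 \<open>0 < \<alpha>\<close> by (intro mult_left_mono) auto
        then show "\<bar>Y i (Suc j)\<bar> + (X (Suc i) - X i) * p (Suc i) / \<alpha> \<le> Q (Suc i) * E (Suc j)"
          using Suc.IH Suc.prems by (simp add: Q_Suc distrib_right)
      qed
    qed
  qed
  then show ?thesis by (simp add: Q_def E_def)
qed

section \<open>Comparison principle for the transport operator\<close>

lemma left_derivative_at_maximum:
  fixes g :: "real \<Rightarrow> real"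
  assumes d: "(g has_real_derivative d) (at_left x)" and "y < x"
    and max: "\<And>z. z \<in> {y..x} \<Longrightarrow> g z \<le> g x"
  shows "0 \<le> d"
proof (rule tendsto_lowerbound)
  show "((\<lambda>z. (g z - g x) / (z - x)) \<longlongrightarrow> d) (at_left x)"
    using d by (simp add: has_field_derivative_iff)
  have "\<forall>\<^sub>F z in at_left x. z \<in> {y<..<x}" by (rule eventually_at_leftI[OF _ \<open>y < x\<close>])
  then show "\<forall>\<^sub>F z in at_left x. 0 \<le> (g z - g x) / (z - x)"
    by eventually_elim (use max in \<open>auto intro!: divide_nonpos_neg\<close>)
qed simp

text \<open>
  At a maximum of \<open>e - \<delta> x\<close> with \<open>x > 0\<close> the derivatives from the left in \<open>x\<close> and in \<open>t\<close> are
  nonnegative, which contradicts the differential inequality for every \<open>\<delta> > 0\<close>. Only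
  one-sided derivatives occur, so that the principle applies to piecewise smooth functions with kinks
  along the mesh lines. Initial values are not prescribed: for \<open>t = 0\<close> the inequality without the
  time derivative plays the role of a boundary condition.
\<close>

lemma transport_comparison:
  fixes e a :: "real \<Rightarrow> real \<Rightarrow> real"
  assumes "0 \<le> L" "0 \<le> T"
    and cont: "continuous_on ({0..L} \<times> {0..T}) (\<lambda>(x, t). e x t)"
    and a: "\<And>x t. x \<in> {0..L} \<Longrightarrow> t \<in> {0..T} \<Longrightarrow> 0 < a x t"
    and inflow: "\<And>t. t \<in> {0..T} \<Longrightarrow> e 0 t \<le> 0"
    and sub: "\<And>x t. x \<in> {0<..L} \<Longrightarrow> t \<in> {0..T} \<Longrightarrow>
      \<exists>p q. ((\<lambda>y. e y t) has_real_derivative p) (at_left x) \<and>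
        (if t = 0 then q = 0 else ((\<lambda>s. e x s) has_real_derivative q) (at_left t)) \<and>
        q + a x t * p \<le> 0"
    and "x \<in> {0..L}" "t \<in> {0..T}"
  shows "e x t \<le> 0"
proof -
  have "e x t \<le> \<delta> * L" if "\<delta> > 0" for \<delta>
  proof -
    define z where "z = (\<lambda>(y, s). e y s - \<delta> * y)"
    have "continuous_on ({0..L} \<times> {0..T}) z"
      unfolding z_def case_prod_beta
      using cont by (intro continuous_intros) (simp add: case_prod_beta)
    moreover have "compact ({0..L} \<times> {0..T})" by (intro compact_Times) auto
    moreover have "{0..L} \<times> {0..T} \<noteq> {}" using assms(1,2) by auto
    ultimately obtain y s where ys: "y \<in> {0..L}" "s \<in> {0..T}"
      and max: "\<And>y' s'. y' \<in> {0..L} \<Longrightarrow> s' \<in> {0..T} \<Longrightarrow> z (y', s') \<le> z (y, s)"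
      using continuous_attains_sup[of "{0..L} \<times> {0..T}" z] by fast
    have "y = 0"
    proof (rule ccontr)
      assume "y \<noteq> 0"
      then have y: "y \<in> {0<..L}" using ys by auto
      obtain p q where p: "((\<lambda>y. e y s) has_real_derivative p) (at_left y)"
        and q: "if s = 0 then q = 0 else ((\<lambda>s. e y s) has_real_derivative q) (at_left s)"
        and pq: "q + a y s * p \<le> 0"
        using sub[OF y ys(2)] by blast
      have "((\<lambda>y. z (y, s)) has_real_derivative p - \<delta>) (at_left y)"
        unfolding z_def by (auto intro!: derivative_eq_intros p)
      then have "0 \<le> p - \<delta>"
        by (rule left_derivative_at_maximum[where y = 0]) (use y ys max in auto)
      moreover have "0 \<le> q"
      proof (cases "s = 0")
        case False
        then have "((\<lambda>s. z (y, s)) has_real_derivative q) (at_left s)"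
          unfolding z_def using q by (auto intro!: derivative_eq_intros)
        then show ?thesis
          by (rule left_derivative_at_maximum[where y = 0]) (use False ys max in auto)
      qed (use q in simp)
      moreover have "0 < a y s" using a ys by blast
      ultimately have "0 < q + a y s * p" using \<open>\<delta> > 0\<close> by (intro add_nonneg_pos mult_pos_pos) auto
      with pq show False by simp
    qed
    then have "e x t - \<delta> * x \<le> 0"
      using max[OF assms(7,8)] inflow[OF ys(2)] by (simp add: z_def)
    moreover have "\<delta> * x \<le> \<delta> * L" using \<open>\<delta> > 0\<close> assms(7) by simp
    ultimately show ?thesis by simp
  qed
  note le = this
  show ?thesis
  proof (rule field_le_epsilon)
    fix r :: real assume "0 < r"
    then have "e x t \<le> r / (L + 1) * L" using \<open>0 \<le> L\<close> by (intro le) auto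
    also have "\<dots> \<le> r" using \<open>0 < r\<close> \<open>0 \<le> L\<close> by (simp add: field_simps)
    finally show "e x t \<le> 0 + r" by simp
  qed
qed
text \<open>
  For \<open>t = 0\<close> the initial condition is the stationary equation \<open>a w\<^sub>x = f\<close>, which is the form that
  \<open>transport_comparison\<close> expects there.
\<close>

lemma layer_solution_left_derivatives:
  assumes sol: "layer_solution L T a f w"
    and f: "continuous_on {0..L} f" and a: "continuous_on {0..L} (\<lambda>x. a x 0)"
    and pos: "\<And>x. x \<in> {0..L} \<Longrightarrow> 0 < a x 0"
    and x: "x \<in> {0<..L}" and t: "t \<in> {0..T}"
  shows "\<exists>p q. ((\<lambda>y. w y t) has_real_derivative p) (at_left x) \<and>
    (if t = 0 then q = 0 else ((\<lambda>s. w x s) has_real_derivative q) (at_left t)) \<and>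
    q + a x t * p = f x"
proof -
  have left: "(h has_real_derivative d) (at_left z)"
    if "(h has_real_derivative d) (at z within {0..l})" "z \<in> {0<..l}" for h d and z l :: real
    using DERIV_subset[OF that(1), of "{0..z}"] that(2) by (simp add: at_within_Icc_at_left)
  obtain wx wt where part: "has_partials L T w wx wt"
    and pde: "\<And>x t. x \<in> {0<..L} \<Longrightarrow> t \<in> {0<..T} \<Longrightarrow> wt x t + a x t * wx x t = f x"
    using sol unfolding layer_solution_def by blast
  show ?thesis
  proof (cases "t = 0")
    case True
    have "continuous_on {0..L} (\<lambda>s. f s / a s 0)"
      using f a pos by (intro continuous_on_divide) force+
    then have "((\<lambda>u. integral {0..u} (\<lambda>s. f s / a s 0)) has_real_derivative f x / a x 0) (at x within {0..L})"
      using x by (intro integral_has_real_derivative) auto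
    then have "((\<lambda>y. w y 0) has_real_derivative f x / a x 0) (at x within {0..L})"
    proof (rule has_field_derivative_transform_within[OF _ zero_less_one])
      show "integral {0..u} (\<lambda>s. f s / a s 0) = w u 0" if "u \<in> {0..L}" for u
        using sol that by (auto simp: layer_solution_def)
    qed (use x in auto)
    then show ?thesis using True left x pos[of x] by (intro exI[of _ "f x / a x 0"] exI[of _ 0]) auto
  next
    case False
    have xt: "x \<in> {0..L}" "t \<in> {0..T}" "t \<in> {0<..T}" using x t False by auto
    have "((\<lambda>y. w y t) has_real_derivative wx x t) (at x within {0..L})"
      and "((\<lambda>s. w x s) has_real_derivative wt x t) (at t within {0..T})"
      using part xt unfolding has_partials_def by blast+
    then show ?thesis using left x xt pde[OF x xt(3)] False
      by (intro exI[of _ "wx x t"] exI[of _ "wt x t"]) auto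
  qed
qed

text \<open>
  Composing a barrier with \<open>max y s\<close> switches its derivative on behind the point \<open>s\<close>, where
  the source need not be resolved by the mesh.
\<close>

lemma has_real_derivative_at_left_max:
  fixes h :: "real \<Rightarrow> real"
  assumes "\<And>y. (h has_real_derivative h' y) (at y)"
  shows "((\<lambda>y. h (max y s)) has_real_derivative (if s < x then h' x else 0)) (at_left x)"
proof (cases "s < x")
  case True
  have "((\<lambda>y. h (max y s)) has_real_derivative h' x) (at x)"
  proof (rule has_field_derivative_transform_within_open)
    show "(h has_real_derivative h' x) (at x)" by (rule assms)
    show "open {s<..}" by simp
  qed (use True in \<open>auto simp: max_def\<close>)
  then show ?thesis using True by (simp add: has_field_derivative_at_within)
next
  case False
  have "((\<lambda>y. h (max y s)) has_real_derivative 0) (at x within {..x})"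
  proof (rule has_field_derivative_transform_within[OF _ zero_less_one])
    show "((\<lambda>y. h s) has_real_derivative 0) (at x within {..x})" by simp
  qed (use False in \<open>auto simp: max_def\<close>)
  then have "((\<lambda>y. h (max y s)) has_real_derivative 0) (at_left x)"
    by (rule DERIV_subset) auto
  then show ?thesis using False by simp
qed

section \<open>Bounds for the transport speed\<close>

text \<open>
  The smoothness of the speed is used through finite differences only. The last assumption is the trace
  of \<open>a\<^sub>t(0,0) = 0\<close>: time differences near the initial line are small close to the corner.
\<close>

locale transport_speed =
  fixes L T \<alpha> A :: real and a :: "real \<Rightarrow> real \<Rightarrow> real"
  assumes L_pos: "0 < L" and T_pos: "0 < T" and alpha_pos: "0 < \<alpha>" and A_nonneg: "0 \<le> A"
    and a_ge: "\<And>x t. x \<in> {0..L} \<Longrightarrow> t \<in> {0..T} \<Longrightarrow> \<alpha> \<le> a x t"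
    and a_le: "\<And>x t. x \<in> {0..L} \<Longrightarrow> t \<in> {0..T} \<Longrightarrow> a x t \<le> A"
    and a_cont: "continuous_on {0..L} (\<lambda>x. a x 0)"
    and a_lip: "\<And>x y t s. x \<in> {0..L} \<Longrightarrow> y \<in> {0..L} \<Longrightarrow> t \<in> {0..T} \<Longrightarrow> s \<in> {0..T} \<Longrightarrow>
      \<bar>a x t - a y s\<bar> \<le> A * (\<bar>x - y\<bar> + \<bar>t - s\<bar>)"
    and a_second: "\<And>x t k. x \<in> {0..L} \<Longrightarrow> 0 \<le> t \<Longrightarrow> 0 \<le> k \<Longrightarrow> t + 2 * k \<le> T \<Longrightarrow>
      \<bar>a x (t + 2 * k) - 2 * a x (t + k) + a x t\<bar> \<le> A * k\<^sup>2"
    and a_corner: "\<And>x t. x \<in> {0..L} \<Longrightarrow> t \<in> {0..T} \<Longrightarrow> \<bar>a x t - a x 0\<bar> \<le> A * t * (x + t)"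

lemma Ck_rect_continuous: "Ck_rect n L T g \<Longrightarrow> continuous_on ({0..L} \<times> {0..T}) (\<lambda>(x, t). g x t)"
  by (cases n) auto

lemma continuous_on_rect_bounded:
  fixes g :: "real \<Rightarrow> real \<Rightarrow> real"
  assumes "continuous_on ({0..L} \<times> {0..T}) (\<lambda>(x, t). g x t)"
  shows "\<exists>B. \<forall>x\<in>{0..L}. \<forall>t\<in>{0..T}. \<bar>g x t\<bar> \<le> B"
proof -
  have "bounded ((\<lambda>(x, t). g x t) ` ({0..L} \<times> {0..T}))"
    by (intro compact_imp_bounded compact_continuous_image assms compact_Times) auto
  then obtain B where B: "\<And>z. z \<in> (\<lambda>(x, t). g x t) ` ({0..L} \<times> {0..T}) \<Longrightarrow> norm z \<le> B"
    unfolding bounded_iff by blast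
  show ?thesis
  proof (intro exI ballI)
    fix x t assume "x \<in> {0..L}" "t \<in> {0..T}"
    then have "(x, t) \<in> {0..L} \<times> {0..T}" by simp
    from B[OF imageI[OF this]] show "\<bar>g x t\<bar> \<le> B" by simp
  qed
qed

lemma lipschitz_of_partials:
  assumes part: "has_partials L T g gx gt"
    and B: "\<And>x t. x \<in> {0..L} \<Longrightarrow> t \<in> {0..T} \<Longrightarrow> \<bar>gx x t\<bar> \<le> B \<and> \<bar>gt x t\<bar> \<le> B"
    and xy: "x \<in> {0..L}" "y \<in> {0..L}" and ts: "t \<in> {0..T}" "s \<in> {0..T}"
  shows "\<bar>g x t - g y s\<bar> \<le> B * (\<bar>x - y\<bar> + \<bar>t - s\<bar>)"
proof -
  have "norm (g x t - g y t) \<le> B * norm (x - y)"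
    by (rule field_differentiable_bound[where S = "{0..L}" and f = "\<lambda>x. g x t" and f' = "\<lambda>x. gx x t"])
      (use part B xy ts in \<open>auto simp: has_partials_def\<close>)
  moreover have "norm (g y t - g y s) \<le> B * norm (t - s)"
    by (rule field_differentiable_bound[where S = "{0..T}" and f = "g y" and f' = "gt y"])
      (use part B xy ts in \<open>auto simp: has_partials_def\<close>)
  ultimately show ?thesis by (simp add: distrib_left)
qed

text \<open>
  Continuous partial derivatives on the closed rectangle are bounded, and the mean value inequality
  turns the bounds for \<open>a\<^sub>x, a\<^sub>t, a\<^sub>t\<^sub>x, a\<^sub>t\<^sub>t\<close> into the difference estimates.
\<close>

lemma transport_speed_exists:
  assumes "0 < L" "0 < T" and C3: "Ck_rect 3 L T a" and "0 < \<alpha>"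
    and ge: "\<And>x t. x \<in> {0..L} \<Longrightarrow> t \<in> {0..T} \<Longrightarrow> a x t \<ge> \<alpha>"
    and corner: "((\<lambda>t. a 0 t) has_real_derivative 0) (at 0 within {0..T})"
  shows "\<exists>A. transport_speed L T \<alpha> A a"
proof -
  obtain a_x a_t where part: "has_partials L T a a_x a_t"
    and C2: "Ck_rect 2 L T a_x" "Ck_rect 2 L T a_t"
    and cont: "continuous_on ({0..L} \<times> {0..T}) (\<lambda>(x, t). a x t)"
  proof -
    have "Ck_rect (Suc 2) L T a" using C3 by simp
    then show ?thesis unfolding Ck_rect.simps(2) using that by blast
  qed
  obtain a_tx a_tt where part_t: "has_partials L T a_t a_tx a_tt"
    and C1: "Ck_rect 1 L T a_tx" "Ck_rect 1 L T a_tt"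
  proof -
    have "Ck_rect (Suc 1) L T a_t" using C2(2) by (simp only: Suc_1)
    then show ?thesis unfolding Ck_rect.simps(2) using that by blast
  qed
  have C0: "continuous_on ({0..L} \<times> {0..T}) (\<lambda>(x, t). g x t)" if "g \<in> {a_x, a_t, a_tx, a_tt}" for g
    using that C2 C1 by (auto intro: Ck_rect_continuous)
  obtain B0 where B0: "\<forall>x\<in>{0..L}. \<forall>t\<in>{0..T}. \<bar>a x t\<bar> \<le> B0"
    using continuous_on_rect_bounded[OF cont] by blast
  obtain B1 where B1: "\<forall>x\<in>{0..L}. \<forall>t\<in>{0..T}. \<bar>a_x x t\<bar> \<le> B1"
    using continuous_on_rect_bounded[OF C0, of a_x] by auto
  obtain B2 where B2: "\<forall>x\<in>{0..L}. \<forall>t\<in>{0..T}. \<bar>a_t x t\<bar> \<le> B2"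
    using continuous_on_rect_bounded[OF C0, of a_t] by auto
  obtain B3 where B3: "\<forall>x\<in>{0..L}. \<forall>t\<in>{0..T}. \<bar>a_tx x t\<bar> \<le> B3"
    using continuous_on_rect_bounded[OF C0, of a_tx] by auto
  obtain B4 where B4: "\<forall>x\<in>{0..L}. \<forall>t\<in>{0..T}. \<bar>a_tt x t\<bar> \<le> B4"
    using continuous_on_rect_bounded[OF C0, of a_tt] by auto
  define A where "A = \<bar>B0\<bar> + \<bar>B1\<bar> + \<bar>B2\<bar> + \<bar>B3\<bar> + \<bar>B4\<bar>"
  have A: "0 \<le> A" "B0 \<le> A" "B1 \<le> A" "B2 \<le> A" "B3 \<le> A" "B4 \<le> A" by (auto simp: A_def)
  have bounds: "\<bar>a_x x t\<bar> \<le> A \<and> \<bar>a_t x t\<bar> \<le> A" "\<bar>a_tx x t\<bar> \<le> A \<and> \<bar>a_tt x t\<bar> \<le> A"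
    if "x \<in> {0..L}" "t \<in> {0..T}" for x t
    using B1[rule_format, OF that] B2[rule_format, OF that] B3[rule_format, OF that]
      B4[rule_format, OF that] A by auto
  have lip: "\<bar>a x t - a y s\<bar> \<le> A * (\<bar>x - y\<bar> + \<bar>t - s\<bar>)"
    if "x \<in> {0..L}" "y \<in> {0..L}" "t \<in> {0..T}" "s \<in> {0..T}" for x y t s
    by (rule lipschitz_of_partials[OF part _ that]) (rule bounds(1))
  have lip_t: "\<bar>a_t x t - a_t y s\<bar> \<le> A * (\<bar>x - y\<bar> + \<bar>t - s\<bar>)"
    if "x \<in> {0..L}" "y \<in> {0..L}" "t \<in> {0..T}" "s \<in> {0..T}" for x y t s
    by (rule lipschitz_of_partials[OF part_t _ that]) (rule bounds(2))
  have dt: "((\<lambda>s. a x s) has_real_derivative a_t x t) (at t within {0..T})"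
    if "x \<in> {0..L}" "t \<in> {0..T}" for x t
    using part that unfolding has_partials_def by blast
  have "a_t 0 0 = 0"
  proof (rule vector_derivative_unique_within)
    show "at (0 :: real) within {0..T} \<noteq> bot"
      using \<open>0 < T\<close> by (simp add: trivial_limit_within islimpt_Icc)
    show "((\<lambda>s. a 0 s) has_vector_derivative a_t 0 0) (at 0 within {0..T})"
      using dt[of 0 0] \<open>0 < L\<close> \<open>0 < T\<close> by (simp add: has_real_derivative_iff_has_vector_derivative)
    show "((\<lambda>s. a 0 s) has_vector_derivative 0) (at 0 within {0..T})"
      using corner by (simp add: has_real_derivative_iff_has_vector_derivative)
  qed
  then have at_small: "\<bar>a_t x s\<bar> \<le> A * (x + s)" if "x \<in> {0..L}" "s \<in> {0..T}" for x s
    using lip_t[OF that(1) _ that(2), of 0 0] that \<open>0 < L\<close> \<open>0 < T\<close> by simp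
  have "transport_speed L T \<alpha> A a"
  proof
    show "a x t \<le> A" if "x \<in> {0..L}" "t \<in> {0..T}" for x t
      using bspec[OF bspec[OF B0 that(1)] that(2)] A by linarith
    have "continuous_on {0..L} ((\<lambda>(x, t). a x t) \<circ> (\<lambda>x. (x, 0)))"
      using \<open>0 < T\<close> by (intro continuous_on_compose continuous_intros continuous_on_subset[OF cont]) auto
    then show "continuous_on {0..L} (\<lambda>x. a x 0)" by (simp add: o_def)
    show "\<bar>a x t - a x 0\<bar> \<le> A * t * (x + t)" if "x \<in> {0..L}" "t \<in> {0..T}" for x t
    proof -
      have "norm (a x t - a x 0) \<le> A * (x + t) * norm (t - 0)"
      proof (rule field_differentiable_bound[where S = "{0..t}" and f = "a x" and f' = "a_t x"])
        fix s assume s: "s \<in> {0..t}"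
        then have sT: "s \<in> {0..T}" using that by auto
        show "(a x has_real_derivative a_t x s) (at s within {0..t})"
          using dt[OF that(1) sT] that by (auto intro: DERIV_subset)
        have "A * (x + s) \<le> A * (x + t)" using s A by (intro mult_left_mono) auto
        then show "norm (a_t x s) \<le> A * (x + t)" using at_small[OF that(1) sT] by simp
      qed (use that in auto)
      then show ?thesis using that by (simp add: mult_ac)
    qed
    show "\<bar>a x (t + 2 * k) - 2 * a x (t + k) + a x t\<bar> \<le> A * k\<^sup>2"
      if x: "x \<in> {0..L}" and t: "0 \<le> t" "0 \<le> k" "t + 2 * k \<le> T" for x t k
    proof -
      have "norm ((a x (k + (t + k)) - a x (t + k)) - (a x (k + t) - a x t)) \<le> A * k * norm ((t + k) - t)"
      proof (rule field_differentiable_bound[where S = "{t..t + k}"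
            and f = "\<lambda>s. a x (k + s) - a x s" and f' = "\<lambda>s. a_t x (k + s) - a_t x s"])
        fix s assume s: "s \<in> {t..t + k}"
        then have sT: "s \<in> {0..T}" "k + s \<in> {0..T}" using t by auto
        have "(+) k ` {t..t + k} \<subseteq> {0..T}" using t by auto
        then have "(a x has_real_derivative a_t x (k + s)) (at (k + s) within (+) k ` {t..t + k})"
          by (rule DERIV_subset[OF dt[OF x sT(2)]])
        then have "((\<lambda>s. a x (k + s)) has_real_derivative a_t x (k + s)) (at s within {t..t + k})"
          by (simp only: DERIV_at_within_shift)
        moreover have "(a x has_real_derivative a_t x s) (at s within {t..t + k})"
          using t by (intro DERIV_subset[OF dt[OF x sT(1)]]) auto
        ultimately show "((\<lambda>s. a x (k + s) - a x s) has_real_derivative a_t x (k + s) - a_t x s)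
            (at s within {t..t + k})"
          by (rule DERIV_diff)
        show "norm (a_t x (k + s) - a_t x s) \<le> A * k"
          using lip_t[OF x x sT(2,1)] t by simp
      qed (use t in auto)
      then show ?thesis using t by (simp add: power2_eq_square algebra_simps)
    qed
  qed (use assms A lip in auto)
  then show ?thesis ..
qed

section \<open>Bounds for the difference quotients of the upwind solution\<close>

lemma Dx_Dt_commute: "Dx_minus X (Dt_minus \<tau> W) = Dt_minus \<tau> (Dx_minus X W)"
  by (intro ext) (simp add: Dx_minus_def Dt_minus_def diff_divide_distrib mult.commute)

lemma difference_of_products:
  fixes u v u' v' k :: real
  shows "(u * v - u' * v') / k = u * ((v - v') / k) + (u - u') / k * v'"
  by (simp add: diff_divide_distrib right_diff_distrib left_diff_distrib)

text \<open>
  The following constants depend on the data \<open>L, T, \<alpha>, A, K\<close> only. Stating them explicitly makes it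
  evident that the estimates are uniform in \<open>\<epsilon>\<close> and in the mesh.
\<close>

definition DtW_bound :: "real \<Rightarrow> real \<Rightarrow> real \<Rightarrow> real \<Rightarrow> real" where
  "DtW_bound T \<alpha> A K = 6 * (A * K / \<alpha>) / \<alpha> * exp (A / \<alpha> * T)"

definition DttW_bound :: "real \<Rightarrow> real \<Rightarrow> real \<Rightarrow> real \<Rightarrow> real \<Rightarrow> real" where
  "DttW_bound L T \<alpha> A K =
     (A * K / \<alpha> * (27 + 6 / \<alpha>) +
        (2 * A\<^sup>2 / \<alpha> + A) / \<alpha> * (DtW_bound T \<alpha> A K * L + 6 * K) / \<alpha>) * exp (2 * A / \<alpha> * T)"

definition slope_bound :: "real \<Rightarrow> real \<Rightarrow> real \<Rightarrow> real \<Rightarrow> real \<Rightarrow> real" where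
  "slope_bound L T \<alpha> A K =
     (1 + A / \<alpha>) * (DtW_bound T \<alpha> A K + DttW_bound L T \<alpha> A K + K) / \<alpha>"

text \<open>
  The mesh in space is arbitrary: the layer enters the difference quotients only through the mass of
  the weight, which is at most \<open>6\<close> on every mesh.
\<close>

locale upwind_layer = transport_speed +
  fixes K \<epsilon> :: real and f :: "real \<Rightarrow> real"
    and N M :: nat and X :: "nat \<Rightarrow> real" and W :: "nat \<Rightarrow> nat \<Rightarrow> real"
  assumes eps_pos: "0 < \<epsilon>" and K_nonneg: "0 \<le> K"
    and f_bound: "\<And>x. x \<in> {0..L} \<Longrightarrow> \<bar>f x\<bar> \<le> K * (x\<^sup>2 / \<epsilon> ^ 3 * exp (- (x / \<epsilon>)))"
    and X_0: "X 0 = 0" and X_N: "X N = L" and X_less: "\<And>i. i \<in> {1..N} \<Longrightarrow> X (i - 1) < X i"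
    and M_pos: "0 < M"
    and scheme: "upwind_solution X (mesh_t T M) N M a f W"
begin

definition k :: real where "k = T / real M"

abbreviation tau :: "nat \<Rightarrow> real" where "tau \<equiv> mesh_t T M"
abbreviation co :: "nat \<Rightarrow> nat \<Rightarrow> real" where "co i j \<equiv> a (X i) (tau j)"
abbreviation Dtco :: "nat \<Rightarrow> nat \<Rightarrow> real" where "Dtco \<equiv> Dt_minus tau co"
abbreviation DxW :: "nat \<Rightarrow> nat \<Rightarrow> real" where "DxW \<equiv> Dx_minus X W"
abbreviation DtW :: "nat \<Rightarrow> nat \<Rightarrow> real" where "DtW \<equiv> Dt_minus tau W"
abbreviation DttW :: "nat \<Rightarrow> nat \<Rightarrow> real" where "DttW \<equiv> Dt_minus tau DtW"
abbreviation DxtW :: "nat \<Rightarrow> nat \<Rightarrow> real" where "DxtW \<equiv> Dx_minus X DtW"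

lemma k_pos: "0 < k" using T_pos M_pos by (simp add: k_def)

lemma tau_eq: "tau j = real j * k" by (simp add: mesh_t_def k_def)

lemma Mk: "real M * k = T" using M_pos by (simp add: k_def)

lemma tau_diff: "1 \<le> j \<Longrightarrow> tau j - tau (j - 1) = k"
  by (simp add: tau_eq of_nat_diff algebra_simps)

lemma Dt_eq: "1 \<le> j \<Longrightarrow> Dt_minus tau Y i j = (Y i j - Y i (j - 1)) / k"
  by (simp only: Dt_minus_def tau_diff)

lemma Dt_0: "Dt_minus tau Y i 0 = 0"
  by (simp add: Dt_minus_def)

lemma tau_in: "j \<le> M \<Longrightarrow> tau j \<in> {0..T}"
  using Mk k_pos mult_right_mono[of "real j" "real M" k] by (simp add: tau_eq)

lemma X_mono: "i \<le> i' \<Longrightarrow> i' \<le> N \<Longrightarrow> X i \<le> X i'"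
proof (induction i' rule: dec_induct)
  case (step n)
  then show ?case using X_less[of "Suc n"] by auto
qed simp

lemma X_in: "i \<le> N \<Longrightarrow> X i \<in> {0..L}"
  using X_mono[of 0 i] X_mono[of i N] X_0 X_N by auto

lemma co_ge: "i \<le> N \<Longrightarrow> j \<le> M \<Longrightarrow> \<alpha> \<le> co i j"
  using a_ge X_in tau_in by blast

lemma growth_le:
  assumes "0 \<le> B" "j \<le> M"
  shows "(1 + B * k) ^ j \<le> exp (B * T)"
proof -
  have "(1 + B * k) ^ j \<le> exp (B * k) ^ j"
    using exp_ge_add_one_self[of "B * k"] assms k_pos by (intro power_mono) auto
  also have "\<dots> = exp (B * tau j)"
    by (simp add: tau_eq mult_ac flip: exp_of_nat_mult)
  also have "\<dots> \<le> exp (B * T)" using tau_in[OF assms(2)] assms(1) by (simp add: mult_left_mono)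
  finally show ?thesis .
qed

lemma f_le_weight: "x \<in> {0..L} \<Longrightarrow> \<bar>f x\<bar> \<le> K * layer_weight \<epsilon> x"
  using f_bound[of x] mult_left_mono[OF layer_profile_le[of \<epsilon> x] K_nonneg] eps_pos by force

lemma weight_nonneg: "i \<le> N \<Longrightarrow> 0 \<le> layer_weight \<epsilon> (X i)"
  using layer_weight_nonneg eps_pos X_in by force

text \<open>
  By \<open>layer_weight_cell\<close> the sum is at most the integral of \<open>u + v \<Phi>\<close>, whatever the mesh.
\<close>

lemma weight_sum_le:
  assumes "0 \<le> u" "0 \<le> v" "i \<le> N"
  shows "(\<Sum>l=1..i. (X l - X (l - 1)) * (u + v * layer_weight \<epsilon> (X l))) \<le> u * L + 6 * v"
proof -
  have "(\<Sum>l=1..i. (X l - X (l - 1)) * (u + v * layer_weight \<epsilon> (X l)))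
      \<le> u * X i + v * layer_mass \<epsilon> (X i)"
    using \<open>i \<le> N\<close>
  proof (induction i)
    case (Suc i)
    have "v * ((X (Suc i) - X i) * layer_weight \<epsilon> (X (Suc i)))
        \<le> v * (layer_mass \<epsilon> (X (Suc i)) - layer_mass \<epsilon> (X i))"
      using X_less[of "Suc i"] X_in[of i] eps_pos Suc.prems \<open>0 \<le> v\<close>
      by (intro mult_left_mono layer_weight_cell) auto
    then show ?case using Suc by (simp add: algebra_simps)
  qed (simp add: X_0 layer_mass_0)
  also have "\<dots> \<le> u * L + v * 6"
    using assms X_in[OF \<open>i \<le> N\<close>] layer_mass_le[OF eps_pos]
    by (intro add_mono mult_left_mono) auto
  finally show ?thesis by simp
qed

text \<open>
  The case \<open>j = 0\<close> is included. With \<open>0 - 1 = 0\<close> and \<open>0 / 0 = 0\<close> the quotient \<open>DtW i 0\<close> is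
  zero, so the discrete initial condition is the scheme with vanishing time difference. It
  also gives \<open>DtW\<close> the initial value \<open>0\<close> in the estimates below.
\<close>

lemma scheme_eq:
  assumes "i \<in> {1..N}" "j \<le> M"
  shows "DtW i j + co i j * DxW i j = f (X i)"
proof (cases "j = 0")
  case True
  then show ?thesis using scheme assms by (simp add: upwind_solution_def Dt_0 mesh_t_def)
next
  case False
  then show ?thesis using scheme assms by (auto simp: upwind_solution_def)
qed

lemma W_left: "j \<le> M \<Longrightarrow> W 0 j = 0"
  using scheme by (auto simp: upwind_solution_def)

lemma DtW_left: "j \<le> M \<Longrightarrow> DtW 0 j = 0"
  by (simp add: Dt_minus_def W_left)

lemma DttW_left: "j \<le> M \<Longrightarrow> DttW 0 j = 0"
  by (simp add: Dt_minus_def W_left)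

lemma DxW_le:
  assumes "i \<in> {1..N}" "j \<le> M"
  shows "\<bar>DxW i j\<bar> \<le> (\<bar>DtW i j\<bar> + K * layer_weight \<epsilon> (X i)) / \<alpha>"
proof -
  have "\<alpha> * \<bar>DxW i j\<bar> \<le> co i j * \<bar>DxW i j\<bar>"
    using co_ge[of i j] assms by (intro mult_right_mono) auto
  also have "\<dots> = \<bar>f (X i) - DtW i j\<bar>"
    using scheme_eq[OF assms] co_ge[of i j] alpha_pos assms
    by (simp add: abs_mult flip: abs_mult[of "co i j"] scheme_eq[OF assms])
  also have "\<dots> \<le> \<bar>DtW i j\<bar> + K * layer_weight \<epsilon> (X i)"
    using f_le_weight[OF X_in[of i]] assms by auto
  finally show ?thesis using alpha_pos by (simp add: field_simps)
qed

lemma Dtco_le: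
  assumes "i \<le> N" "j \<in> {1..M}"
  shows "\<bar>Dtco i j\<bar> \<le> A"
proof -
  have "\<bar>co i j - co i (j - 1)\<bar> \<le> A * k"
    using a_lip[OF X_in X_in tau_in tau_in, of i i j "j - 1"] assms tau_diff[of j] k_pos by auto
  then show ?thesis using k_pos assms by (simp add: Dt_eq field_simps)
qed

text \<open>
  The time difference of the scheme. The time difference of \<open>a D\<^sub>xW\<close> follows the product rule, and
  \<open>D\<^sub>tD\<^sub>x = D\<^sub>xD\<^sub>t\<close>; at \<open>j = 1\<close> the initial condition takes the place of the scheme.
\<close>

lemma DtW_eq:
  assumes "i \<in> {1..N}" "j \<in> {1..M}"
  shows "DttW i j + co i j * DxtW i j = - (Dtco i j * DxW i (j - 1))"
proof -
  have j: "1 \<le> j" "j \<le> M" "j - 1 \<le> M" using assms by auto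
  have "(DtW i j - DtW i (j - 1)) + (co i j * DxW i j - co i (j - 1) * DxW i (j - 1)) = 0"
    using scheme_eq[OF assms(1) j(2)] scheme_eq[OF assms(1) j(3)] by linarith
  then have "DttW i j + (co i j * DxW i j - co i (j - 1) * DxW i (j - 1)) / k = 0"
    unfolding Dt_eq[OF j(1), of DtW] add_divide_distrib[symmetric] by simp
  moreover have "(co i j * DxW i j - co i (j - 1) * DxW i (j - 1)) / k
      = co i j * Dt_minus tau DxW i j + Dtco i j * DxW i (j - 1)"
    using assms by (simp only: difference_of_products) (simp add: Dt_eq)
  ultimately show ?thesis by (simp add: Dx_Dt_commute)
qed

text \<open>
  In the equation for \<open>DtW\<close> the slope \<open>D\<^sub>xW\<close> is eliminated by the scheme, which leaves a source of
  bounded mass and a feedback from the previous time level.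
\<close>

lemma DtW_le:
  assumes "i \<le> N" "j \<le> M"
  shows "\<bar>DtW i j\<bar> \<le> DtW_bound T \<alpha> A K"
proof -
  define q where "q = A * K / \<alpha>"
  define p where "p i = q * layer_weight \<epsilon> (X i)" for i
  have q: "0 \<le> q" using A_nonneg K_nonneg alpha_pos by (simp add: q_def)
  have "\<bar>DtW i j\<bar> \<le> (0 + (\<Sum>l=1..i. (X l - X (l - 1)) * p l) / \<alpha>) * (1 + A / \<alpha> * k) ^ (j - 0)"
  proof (rule discrete_comparison[where N = N and M = M and \<tau> = tau and c = co])
    fix i j assume i: "i \<in> {1..N}" and j: "j \<in> {0<..M}"
    have "\<bar>DttW i j + co i j * DxtW i j\<bar> = \<bar>Dtco i j\<bar> * \<bar>DxW i (j - 1)\<bar>"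
      using DtW_eq[of i j] i j by (simp add: abs_mult)
    also have "\<dots> \<le> A * ((\<bar>DtW i (j - 1)\<bar> + K * layer_weight \<epsilon> (X i)) / \<alpha>)"
      using Dtco_le[of i j] DxW_le[of i "j - 1"] i j A_nonneg by (intro mult_mono) auto
    also have "\<dots> = p i + A / \<alpha> * \<bar>DtW i (j - 1)\<bar>"
      by (simp add: p_def q_def add_divide_distrib algebra_simps)
    finally show "\<bar>DttW i j + co i j * DxtW i j\<bar> \<le> p i + A / \<alpha> * \<bar>DtW i (j - 1)\<bar>" .
  next
    show "0 \<le> p i" if "i \<in> {1..N}" for i
      unfolding p_def using q weight_nonneg[of i] that by (intro mult_nonneg_nonneg) auto
  qed (use assms X_less tau_diff k_pos co_ge alpha_pos A_nonneg DtW_left Dt_0 in auto)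
  also have "\<dots> \<le> (6 * q / \<alpha>) * exp (A / \<alpha> * T)"
  proof (rule mult_mono)
    show "0 + (\<Sum>l=1..i. (X l - X (l - 1)) * p l) / \<alpha> \<le> 6 * q / \<alpha>"
      using weight_sum_le[of 0 q i] q assms alpha_pos by (simp add: p_def divide_right_mono)
  qed (use growth_le[of "A / \<alpha>" j] assms A_nonneg alpha_pos q k_pos in auto)
  finally show ?thesis by (simp add: DtW_bound_def q_def)
qed

lemma DtW_bound_nonneg: "0 \<le> DtW_bound T \<alpha> A K"
  using A_nonneg K_nonneg alpha_pos by (simp add: DtW_bound_def)

lemma DxW_le': 
  assumes "i \<in> {1..N}" "j \<le> M"
  shows "\<bar>DxW i j\<bar> \<le> (DtW_bound T \<alpha> A K + K * layer_weight \<epsilon> (X i)) / \<alpha>"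
proof (rule order_trans[OF DxW_le[OF assms]])
  show "(\<bar>DtW i j\<bar> + K * layer_weight \<epsilon> (X i)) / \<alpha>
      \<le> (DtW_bound T \<alpha> A K + K * layer_weight \<epsilon> (X i)) / \<alpha>"
    using DtW_le[of i j] assms alpha_pos by (intro divide_right_mono) auto
qed

text \<open>
  Since \<open>DtW\<close> vanishes at \<open>t = 0\<close>, the claim is \<open>DtW i 1 = O(k)\<close>. The right-hand side at the first
  level is at most \<open>A (x + k) / \<alpha>\<close> times the source. The part with \<open>x\<close> is bounded by a constant and is
  charged to the time step. The part with \<open>k\<close> is bounded by \<open>k\<close> times the weight; it has
  mass \<open>O(k)\<close> and is charged to the space steps.
\<close>

lemma DttW_first_level:
  assumes "i \<le> N"
  shows "\<bar>DttW i 1\<bar> \<le> A * K / \<alpha> * (27 + 6 / \<alpha>)"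
proof -
  define q where "q = A * K / \<alpha>"
  have q: "0 \<le> q" using A_nonneg K_nonneg alpha_pos by (simp add: q_def)
  \<comment> \<open>The two charges of the right-hand side, constant per unit of time and weighted in space.\<close>
  define R where "R i = k * (27 * q + (\<Sum>l=1..i. (X l - X (l - 1)) * (0 + q * layer_weight \<epsilon> (X l))) / \<alpha>)" for i
  have "\<bar>DtW i 1\<bar> \<le> R i"
    using assms
  proof (induction i)
    case 0
    then show ?case using M_pos q k_pos by (simp add: DtW_left R_def)
  next
    case (Suc i)
    have i: "Suc i \<in> {1..N}" using Suc.prems by simp
    have h: "X i < X (Suc i)" using X_less[OF i] by simp
    have x: "X (Suc i) \<in> {0..L}" using X_in[of "Suc i"] i by auto
    have P: "\<bar>DxW (Suc i) 0\<bar> \<le> \<bar>f (X (Suc i))\<bar> / \<alpha>"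
    proof -
      have "\<alpha> * \<bar>DxW (Suc i) 0\<bar> \<le> co (Suc i) 0 * \<bar>DxW (Suc i) 0\<bar>"
        using co_ge[of "Suc i" 0] i by (intro mult_right_mono) auto
      also have "\<dots> = \<bar>f (X (Suc i))\<bar>"
        using scheme_eq[OF i, of 0] co_ge[of "Suc i" 0] alpha_pos i
        by (simp add: Dt_0 abs_mult flip: scheme_eq[OF i, of 0])
      finally show ?thesis using alpha_pos by (simp add: field_simps)
    qed
    have D: "\<bar>Dtco (Suc i) 1\<bar> \<le> A * (X (Suc i) + k)"
    proof -
      have "\<bar>co (Suc i) 1 - co (Suc i) 0\<bar> \<le> A * k * (X (Suc i) + k)"
        using a_corner[OF x tau_in[of 1]] M_pos by (simp add: tau_eq)
      then show ?thesis using k_pos by (simp add: Dt_eq abs_divide field_simps)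
    qed
    have P': "\<bar>DxW (Suc i) 0\<bar> \<le> K * (X (Suc i) ^ 2 / \<epsilon> ^ 3 * exp (- (X (Suc i) / \<epsilon>))) / \<alpha>"
      using order_trans[OF P divide_right_mono[OF f_bound[OF x]]] alpha_pos by simp
    \<comment> \<open>The factor \<open>x\<close> meets the source profile itself, the factor \<open>k\<close> its majorant, the weight.\<close>
    have r: "\<bar>Dtco (Suc i) 1 * DxW (Suc i) 0\<bar> \<le> 27 * q + k * (q * layer_weight \<epsilon> (X (Suc i)))"
    proof -
      let ?F = "X (Suc i) ^ 2 / \<epsilon> ^ 3 * exp (- (X (Suc i) / \<epsilon>))"
      have F: "X (Suc i) * ?F \<le> 27" "?F \<le> layer_weight \<epsilon> (X (Suc i))"
        using layer_profile_moment[of \<epsilon>] layer_profile_le[of \<epsilon>] eps_pos x by auto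
      have "\<bar>Dtco (Suc i) 1 * DxW (Suc i) 0\<bar> \<le> (A * (X (Suc i) + k)) * (K * ?F / \<alpha>)"
        unfolding abs_mult
        using D P' x k_pos A_nonneg by (intro mult_mono) auto
      also have "\<dots> = q * (X (Suc i) * ?F) + k * (q * ?F)"
        by (simp add: q_def add_divide_distrib algebra_simps)
      also have "\<dots> \<le> q * 27 + k * (q * layer_weight \<epsilon> (X (Suc i)))"
        using F q k_pos by (intro add_mono mult_left_mono) auto
      finally show ?thesis by simp
    qed
    show ?case
    proof (rule upwind_step)
      show "0 < X (Suc i) - X i" "0 < k" "0 < \<alpha>" "\<alpha> \<le> co (Suc i) 1"
        "0 \<le> k * (q * layer_weight \<epsilon> (X (Suc i)))"
        using h k_pos alpha_pos co_ge[of "Suc i" 1] M_pos i q weight_nonneg[of "Suc i"] by auto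
      show "\<bar>(DtW (Suc i) 1 - DtW (Suc i) 0) / k
          + co (Suc i) 1 * ((DtW (Suc i) 1 - DtW i 1) / (X (Suc i) - X i))\<bar>
        \<le> 27 * q + k * (q * layer_weight \<epsilon> (X (Suc i)))"
      proof -
        have "DttW (Suc i) 1 = (DtW (Suc i) 1 - DtW (Suc i) 0) / k"
          using Dt_eq[of 1 DtW] by simp
        moreover have "DxtW (Suc i) 1 = (DtW (Suc i) 1 - DtW i 1) / (X (Suc i) - X i)"
          by (simp add: Dx_minus_def)
        moreover have "DttW (Suc i) 1 + co (Suc i) 1 * DxtW (Suc i) 1 = - (Dtco (Suc i) 1 * DxW (Suc i) 0)"
          using DtW_eq[OF i, of 1] M_pos by simp
        ultimately show ?thesis using r by (metis abs_minus_cancel)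
      qed
      have "0 \<le> (\<Sum>l=1..Suc i. (X l - X (l - 1)) * (0 + q * layer_weight \<epsilon> (X l)))"
        using X_less weight_nonneg q i
        by (intro sum_nonneg mult_nonneg_nonneg) (auto simp: less_imp_le)
      then show "\<bar>DtW (Suc i) 0\<bar> + k * (27 * q) \<le> R (Suc i)"
        unfolding R_def using alpha_pos k_pos by (simp add: Dt_0)
      show "\<bar>DtW i 1\<bar> + (X (Suc i) - X i) * (k * (q * layer_weight \<epsilon> (X (Suc i)))) / \<alpha> \<le> R (Suc i)"
      proof -
        have "R (Suc i) = R i + (X (Suc i) - X i) * (k * (q * layer_weight \<epsilon> (X (Suc i)))) / \<alpha>"
          by (simp add: R_def add_divide_distrib distrib_left mult.left_commute)
        then show ?thesis using Suc by simp
      qed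
    qed
  qed
  also have "R i \<le> k * (27 * q + 6 * q / \<alpha>)"
    unfolding R_def using weight_sum_le[of 0 q i] assms q k_pos alpha_pos
    by (intro mult_left_mono add_left_mono divide_right_mono) auto
  finally have "\<bar>DtW i 1\<bar> \<le> k * (27 * q + 6 * q / \<alpha>)" .
  then have "\<bar>DtW i 1\<bar> / k \<le> 27 * q + 6 * q / \<alpha>"
    using k_pos by (simp add: divide_le_eq mult.commute)
  moreover have "DttW i 1 = DtW i 1 / k" using Dt_eq[of 1 DtW i] by (simp add: Dt_0)
  ultimately have "\<bar>DttW i 1\<bar> \<le> 27 * q + 6 * q / \<alpha>" using k_pos by (simp add: abs_divide)
  then show ?thesis by (simp add: q_def algebra_simps)
qed

lemma Dttco_le:
  assumes "i \<le> N" "j \<in> {2..M}"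
  shows "\<bar>Dt_minus tau Dtco i j\<bar> \<le> A"
proof -
  obtain n where j: "j = Suc (Suc n)" using assms
    by (metis atLeastAtMost_iff add_2_eq_Suc le_Suc_ex)
  have t: "tau n + k = tau (Suc n)" "tau n + 2 * k = tau (Suc (Suc n))"
    by (simp_all add: tau_eq algebra_simps)
  have "\<bar>co i (Suc (Suc n)) - 2 * co i (Suc n) + co i n\<bar> \<le> A * k\<^sup>2"
    using a_second[of "X i" "tau n" k, unfolded t] X_in[of i] tau_in[of n] tau_in[of "Suc (Suc n)"]
      assms j k_pos by auto
  moreover have "Dt_minus tau Dtco i j = (co i (Suc (Suc n)) - 2 * co i (Suc n) + co i n) / k\<^sup>2"
    using k_pos by (simp add: j Dt_eq power2_eq_square field_simps)
  ultimately have "\<bar>Dt_minus tau Dtco i j\<bar> \<le> A * k\<^sup>2 / k\<^sup>2"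
    by (simp only: abs_divide abs_power2 divide_right_mono zero_le_power2)
  then show ?thesis using k_pos by simp
qed

text \<open>
  The second time difference of the scheme. It starts at level \<open>j = 2\<close>, where \<open>D\<^sub>tD\<^sub>ta\<close> and
  \<open>D\<^sub>xW i (j - 2)\<close> refer to actual time levels.
\<close>

lemma DttW_eq:
  assumes "i \<in> {1..N}" "j \<in> {2..M}"
  shows "Dt_minus tau DttW i j + co i j * Dx_minus X DttW i j
    = - (2 * Dtco i j * DxtW i (j - 1)) - Dt_minus tau Dtco i j * DxW i (j - 2)"
proof -
  have j: "j \<in> {1..M}" "j - 1 \<in> {1..M}" "j - 1 - 1 = j - 2" using assms by auto
  have "(DttW i j - DttW i (j - 1)) / k + (co i j * DxtW i j - co i (j - 1) * DxtW i (j - 1)) / k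
      + (Dtco i j * DxW i (j - 1) - Dtco i (j - 1) * DxW i (j - 2)) / k = 0"
  proof -
    have "(DttW i j - DttW i (j - 1)) + (co i j * DxtW i j - co i (j - 1) * DxtW i (j - 1))
        + (Dtco i j * DxW i (j - 1) - Dtco i (j - 1) * DxW i (j - 2)) = 0"
      using DtW_eq[OF assms(1) j(1)] DtW_eq[OF assms(1) j(2)] unfolding j(3) by linarith
    then show ?thesis unfolding add_divide_distrib[symmetric] by simp
  qed
  moreover have "(co i j * DxtW i j - co i (j - 1) * DxtW i (j - 1)) / k
      = co i j * Dx_minus X DttW i j + Dtco i j * DxtW i (j - 1)"
    using j by (simp only: difference_of_products) (simp add: Dx_Dt_commute[of X tau DtW] Dt_eq)
  moreover have "(Dtco i j * DxW i (j - 1) - Dtco i (j - 1) * DxW i (j - 2)) / k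
      = Dtco i j * DxtW i (j - 1) + Dt_minus tau Dtco i j * DxW i (j - 2)"
  proof -
    have "DxtW i (j - 1) = (DxW i (j - 1) - DxW i (j - 2)) / k"
      using j(2) Dt_eq[of "j - 1" DxW i] unfolding Dx_Dt_commute[of X tau W] j(3) by simp
    moreover have "Dt_minus tau Dtco i j = (Dtco i j - Dtco i (j - 1)) / k"
      by (rule Dt_eq) (use assms in auto)
    ultimately show ?thesis by (simp only: difference_of_products)
  qed
  moreover have "Dt_minus tau DttW i j = (DttW i j - DttW i (j - 1)) / k"
    by (rule Dt_eq) (use assms in auto)
  ultimately show ?thesis by linarith
qed

lemma DxtW_le:
  assumes "i \<in> {1..N}" "j \<in> {1..M}"
  shows "\<bar>DxtW i j\<bar> \<le> (\<bar>DttW i j\<bar> + A * ((DtW_bound T \<alpha> A K + K * layer_weight \<epsilon> (X i)) / \<alpha>)) / \<alpha>"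
proof -
  have "\<alpha> * \<bar>DxtW i j\<bar> \<le> co i j * \<bar>DxtW i j\<bar>"
    using co_ge[of i j] assms by (intro mult_right_mono) auto
  also have "\<dots> = \<bar>co i j * DxtW i j\<bar>"
    using co_ge[of i j] alpha_pos assms by (simp add: abs_mult)
  also have "\<dots> = \<bar>DttW i j + Dtco i j * DxW i (j - 1)\<bar>"
    using DtW_eq[OF assms] by linarith
  also have "\<dots> \<le> \<bar>DttW i j\<bar> + \<bar>Dtco i j\<bar> * \<bar>DxW i (j - 1)\<bar>"
    using abs_triangle_ineq by (simp flip: abs_mult)
  also have "\<dots> \<le> \<bar>DttW i j\<bar> + A * ((DtW_bound T \<alpha> A K + K * layer_weight \<epsilon> (X i)) / \<alpha>)"
    using Dtco_le[of i j] DxW_le'[of i "j - 1"] assms A_nonneg by (intro add_left_mono mult_mono) auto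
  finally show ?thesis using alpha_pos by (simp add: field_simps)
qed

lemma DttW_le:
  assumes "i \<le> N" "j \<in> {1..M}"
  shows "\<bar>DttW i j\<bar> \<le> DttW_bound L T \<alpha> A K"
proof -
  define Z where "Z = DtW_bound T \<alpha> A K"
  define c where "c = (2 * A\<^sup>2 / \<alpha> + A) / \<alpha>"
  define q where "q = A * K / \<alpha> * (27 + 6 / \<alpha>)"
  define p where "p i = c * Z + (c * K) * layer_weight \<epsilon> (X i)" for i
  have Z: "0 \<le> Z" unfolding Z_def by (rule DtW_bound_nonneg)
  have c: "0 \<le> c" using A_nonneg alpha_pos by (simp add: c_def)
  have q: "0 \<le> q" using A_nonneg K_nonneg alpha_pos by (simp add: q_def)
  have "\<bar>DttW i j\<bar> \<le> (q + (\<Sum>l=1..i. (X l - X (l - 1)) * p l) / \<alpha>) * (1 + 2 * A / \<alpha> * k) ^ (j - 1)"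
  proof (rule discrete_comparison[where N = N and M = M and \<tau> = tau and c = co])
    fix i j assume i: "i \<in> {1..N}" and "j \<in> {1<..M}"
    then have j: "j \<in> {2..M}" and j1: "j - 1 \<in> {1..M}" and j2: "j - 2 \<le> M" and j0: "j \<in> {1..M}"
      by auto
    define P where "P = (Z + K * layer_weight \<epsilon> (X i)) / \<alpha>"
    have "\<bar>Dt_minus tau DttW i j + co i j * Dx_minus X DttW i j\<bar>
        \<le> 2 * (\<bar>Dtco i j\<bar> * \<bar>DxtW i (j - 1)\<bar>) + \<bar>Dt_minus tau Dtco i j\<bar> * \<bar>DxW i (j - 2)\<bar>"
      unfolding DttW_eq[OF i j] abs_mult[symmetric] by linarith
    also have "\<dots> \<le> 2 * (A * ((\<bar>DttW i (j - 1)\<bar> + A * P) / \<alpha>)) + A * P"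
      using Dtco_le[OF _ j0, of i] DxtW_le[OF i j1] Dttco_le[OF _ j, of i] DxW_le'[OF i j2] i A_nonneg
      by (intro add_mono mult_left_mono[of _ _ "2 :: real"] mult_mono) (auto simp: P_def Z_def)
    also have "\<dots> = p i + 2 * A / \<alpha> * \<bar>DttW i (j - 1)\<bar>"
      using alpha_pos by (simp add: p_def P_def c_def field_simps power2_eq_square)
    finally show "\<bar>Dt_minus tau DttW i j + co i j * Dx_minus X DttW i j\<bar>
      \<le> p i + 2 * A / \<alpha> * \<bar>DttW i (j - 1)\<bar>" .
  next
    show "\<bar>DttW i 1\<bar> \<le> q" if "i \<in> {0..N}" for i
      using DttW_first_level[of i] that by (simp add: q_def)
  qed (use assms X_less tau_diff k_pos co_ge alpha_pos A_nonneg K_nonneg weight_nonneg q c Z DttW_left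
       in \<open>auto simp: p_def\<close>)
  also have "\<dots> \<le> (q + c * (Z * L + 6 * K) / \<alpha>) * exp (2 * A / \<alpha> * T)"
  proof (rule mult_mono)
    show "q + (\<Sum>l=1..i. (X l - X (l - 1)) * p l) / \<alpha> \<le> q + c * (Z * L + 6 * K) / \<alpha>"
      using weight_sum_le[of "c * Z" "c * K" i] assms alpha_pos c Z K_nonneg
      by (auto simp: p_def algebra_simps intro!: divide_right_mono)
    show "(1 + 2 * A / \<alpha> * k) ^ (j - 1) \<le> exp (2 * A / \<alpha> * T)"
      using assms A_nonneg alpha_pos by (intro growth_le) auto
    show "0 \<le> q + c * (Z * L + 6 * K) / \<alpha>"
      using alpha_pos c Z q K_nonneg L_pos
      by (intro add_nonneg_nonneg divide_nonneg_pos mult_nonneg_nonneg) auto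
    show "0 \<le> (1 + 2 * A / \<alpha> * k) ^ (j - 1)"
      using A_nonneg alpha_pos k_pos by simp
  qed
  finally show ?thesis by (simp add: DttW_bound_def q_def c_def Z_def)
qed

text \<open>
  The scheme and its time difference express \<open>D\<^sub>xW\<close> and \<open>D\<^sub>xD\<^sub>tW\<close> by the time differences, which are
  bounded, and by the source, which is dominated by the weight.
\<close>

lemma slopes_le:
  assumes "i \<in> {1..N}"
  shows "j \<le> M \<Longrightarrow> \<bar>DxW i j\<bar> \<le> slope_bound L T \<alpha> A K * (1 + layer_weight \<epsilon> (X i))"
    and "j \<in> {1..M} \<Longrightarrow> \<bar>DxtW i j\<bar> \<le> slope_bound L T \<alpha> A K * (1 + layer_weight \<epsilon> (X i))"
proof -
  define Z S w where "Z = DtW_bound T \<alpha> A K" and "S = DttW_bound L T \<alpha> A K"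
    and "w = layer_weight \<epsilon> (X i)"
  have Z: "0 \<le> Z" unfolding Z_def by (rule DtW_bound_nonneg)
  have S: "0 \<le> S" unfolding S_def using DttW_le[of 0 1] M_pos by force
  have w: "0 \<le> w" using weight_nonneg assms by (simp add: w_def)
  have sum_le: "Z + K * w \<le> (Z + S + K) * (1 + w)" "S \<le> (Z + S + K) * (1 + w)"
    using Z S w K_nonneg by (simp_all add: algebra_simps)
  have C: "slope_bound L T \<alpha> A K * (1 + w)
      = ((Z + S + K) * (1 + w) + A / \<alpha> * ((Z + S + K) * (1 + w))) / \<alpha>"
  proof -
    have "slope_bound L T \<alpha> A K * (1 + w) = (1 + A / \<alpha>) * ((Z + S + K) * (1 + w)) / \<alpha>"
      by (simp add: slope_bound_def Z_def S_def)
    then show ?thesis by (simp only: distrib_right mult_1)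
  qed
  have "0 \<le> A / \<alpha> * ((Z + S + K) * (1 + w))"
    using A_nonneg alpha_pos Z S w K_nonneg by simp
  then have "(Z + K * w) / \<alpha> \<le> slope_bound L T \<alpha> A K * (1 + w)"
    unfolding C using sum_le alpha_pos by (intro divide_right_mono) auto
  then show "\<bar>DxW i j\<bar> \<le> slope_bound L T \<alpha> A K * (1 + layer_weight \<epsilon> (X i))" if "j \<le> M"
    using DxW_le'[OF assms that] by (simp add: Z_def w_def)
  show "\<bar>DxtW i j\<bar> \<le> slope_bound L T \<alpha> A K * (1 + layer_weight \<epsilon> (X i))" if "j \<in> {1..M}"
  proof -
    have "\<bar>DxtW i j\<bar> \<le> (S + A / \<alpha> * (Z + K * w)) / \<alpha>"
    proof (rule order_trans[OF DxtW_le[OF assms that]])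
      show "(\<bar>DttW i j\<bar> + A * ((DtW_bound T \<alpha> A K + K * layer_weight \<epsilon> (X i)) / \<alpha>)) / \<alpha>
          \<le> (S + A / \<alpha> * (Z + K * w)) / \<alpha>"
        using DttW_le[of i j] assms that alpha_pos
        by (intro divide_right_mono) (auto simp: S_def Z_def w_def)
    qed
    also have "\<dots> \<le> slope_bound L T \<alpha> A K * (1 + w)"
      unfolding C using sum_le alpha_pos A_nonneg
      by (intro divide_right_mono add_mono mult_left_mono) auto
    finally show ?thesis by (simp add: w_def)
  qed
qed

end

section \<open>The interpolant as an approximate solution\<close>

lemma mesh_cell:
  fixes Y :: "nat \<Rightarrow> real"
  assumes "Y 0 = 0" "Y n = l" "x \<in> {0<..l}"
  obtains i where "i \<in> {1..n}" "Y (i - 1) < x" "x \<le> Y i"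
proof -
  define i where "i = (LEAST i. x \<le> Y i)"
  have ex: "x \<le> Y n" using assms by simp
  have "x \<le> Y i" unfolding i_def by (rule LeastI[of "\<lambda>i. x \<le> Y i", OF ex])
  moreover have "i \<le> n" unfolding i_def by (rule Least_le[of "\<lambda>i. x \<le> Y i", OF ex])
  moreover have "i \<noteq> 0" using \<open>x \<le> Y i\<close> assms by (intro notI) auto
  moreover have "Y (i - 1) < x"
    using not_less_Least[of "i - 1" "\<lambda>i. x \<le> Y i"] \<open>i \<noteq> 0\<close> by (simp add: i_def[symmetric] not_le)
  ultimately show ?thesis using that[of i] by simp
qed

context upwind_layer
begin

lemma N_pos: "0 < N"
  using X_0 X_N L_pos by (cases N) auto

lemma x_cell:
  assumes "x \<in> {0..L}"
  obtains i where "i \<in> {1..N}" "x \<in> {X (i - 1)..X i}"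
proof (cases "x = 0")
  case True
  then show ?thesis using that[of 1] N_pos X_0 X_in[of 1] by auto
next
  case False
  then have "x \<in> {0<..L}" using assms by auto
  from mesh_cell[OF X_0 X_N this] obtain i where "i \<in> {1..N}" "X (i - 1) < x" "x \<le> X i" .
  then show ?thesis using that[of i] by auto
qed

lemma t_cell:
  assumes "t \<in> {0..T}"
  obtains j where "j \<in> {1..M}" "t \<in> {tau (j - 1)..tau j}" "t \<noteq> 0 \<longrightarrow> tau (j - 1) < t"
    "t = 0 \<longrightarrow> j = 1"
proof (cases "t = 0")
  case True
  then show ?thesis using that[of 1] M_pos k_pos by (auto simp: tau_eq)
next
  case False
  have "tau 0 = 0" "tau M = T" using Mk by (simp_all add: tau_eq)
  moreover have "t \<in> {0<..T}" using assms False by auto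
  ultimately obtain j where "j \<in> {1..M}" "tau (j - 1) < t" "t \<le> tau j"
    by (rule mesh_cell)
  then show ?thesis using that[of j] False by auto
qed

text \<open>
  The four coefficients on a cell in terms of difference quotients: in particular, the mixed
  coefficient is \<open>D\<^sub>xD\<^sub>tW\<close>, which therefore measures how far the derivatives of the interpolant are
  from the quotients that enter the scheme.
\<close>

lemma interpolant_cell:
  assumes g: "bilinear_interpolant X tau N M W g" and i: "i \<in> {1..N}" and j: "j \<in> {1..M}"
  obtains c0 c1 c2 c3 where
    "\<forall>x\<in>{X (i - 1)..X i}. \<forall>t\<in>{tau (j - 1)..tau j}. g x t = c0 + c1 * x + c2 * t + c3 * x * t"
    "DxW i j = c1 + c3 * tau j" "DxW i (j - 1) = c1 + c3 * tau (j - 1)"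
    "DtW i j = c2 + c3 * X i" "DxtW i j = c3"
proof -
  obtain c0 c1 c2 c3 where
    c: "\<forall>x\<in>{X (i - 1)..X i}. \<forall>t\<in>{tau (j - 1)..tau j}. g x t = c0 + c1 * x + c2 * t + c3 * x * t"
    using g i j unfolding bilinear_interpolant_def by blast
  have h: "0 < X i - X (i - 1)" using X_less[OF i] by simp
  have tj: "tau j - tau (j - 1) = k" using tau_diff j by simp
  have W: "W i' j' = c0 + c1 * X i' + c2 * tau j' + c3 * X i' * tau j'"
    if "i' \<in> {i - 1, i}" "j' \<in> {j - 1, j}" for i' j'
  proof -
    have "X i' \<in> {X (i - 1)..X i}" "tau j' \<in> {tau (j - 1)..tau j}"
      using that h tj k_pos by auto
    moreover have "g (X i') (tau j') = W i' j'"
      using g that i j unfolding bilinear_interpolant_def by auto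
    ultimately show ?thesis using c by force
  qed
  have Dx: "DxW i j' = c1 + c3 * tau j'" if "j' \<in> {j - 1, j}" for j'
  proof -
    have "W i j' - W (i - 1) j' = (c1 + c3 * tau j') * (X i - X (i - 1))"
      using W[of i j'] W[of "i - 1" j'] that by (simp add: algebra_simps)
    then show ?thesis using h by (simp add: Dx_minus_def)
  qed
  have Dt: "DtW i' j = c2 + c3 * X i'" if "i' \<in> {i - 1, i}" for i'
  proof -
    have "W i' j - W i' (j - 1) = (c2 + c3 * X i') * (tau j - tau (j - 1))"
      using W[of i' j] W[of i' "j - 1"] that by (simp add: algebra_simps)
    then show ?thesis using tj k_pos by (simp add: Dt_minus_def)
  qed
  have "DxtW i j = c3 * (X i - X (i - 1)) / (X i - X (i - 1))"
    unfolding Dx_minus_def[of X DtW] using Dt[of i] Dt[of "i - 1"] by (simp add: algebra_simps)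
  then have V: "DxtW i j = c3" using h by simp
  show ?thesis by (rule that[OF c Dx[of j] Dx[of "j - 1"] Dt[of i] V]) simp_all
qed

lemma interpolant_continuous:
  assumes g: "bilinear_interpolant X tau N M W g"
  shows "continuous_on ({0..L} \<times> {0..T}) (\<lambda>(x, t). g x t)"
proof (rule continuous_on_subset)
  let ?U = "\<lambda>(i, j). {X (i - 1)..X i} \<times> {tau (j - 1)..tau j}"
  show "continuous_on (\<Union>ij\<in>{1..N} \<times> {1..M}. ?U ij) (\<lambda>(x, t). g x t)"
  proof (rule continuous_on_closed_Union)
    fix ij assume "ij \<in> {1..N} \<times> {1..M}"
    then obtain i j where ij: "ij = (i, j)" "i \<in> {1..N}" "j \<in> {1..M}" by auto
    show "closed (?U ij)" by (simp add: ij closed_Times)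
    obtain c0 c1 c2 c3 where
      c: "\<forall>x\<in>{X (i - 1)..X i}. \<forall>t\<in>{tau (j - 1)..tau j}. g x t = c0 + c1 * x + c2 * t + c3 * x * t"
      by (rule interpolant_cell[OF g ij(2,3)])
    have "continuous_on (?U ij) (\<lambda>z. c0 + c1 * fst z + c2 * snd z + c3 * fst z * snd z)"
      by (intro continuous_intros)
    then show "continuous_on (?U ij) (\<lambda>(x, t). g x t)"
      by (rule continuous_on_eq) (auto simp: ij c)
  qed simp
  show "{0..L} \<times> {0..T} \<subseteq> (\<Union>ij\<in>{1..N} \<times> {1..M}. ?U ij)"
  proof clarify
    fix x t assume x: "x \<in> {0..L}" and t: "t \<in> {0..T}"
    obtain i where "i \<in> {1..N}" "x \<in> {X (i - 1)..X i}" by (rule x_cell[OF x])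
    moreover obtain j where "j \<in> {1..M}" "t \<in> {tau (j - 1)..tau j}"
      by (rule t_cell[OF t])
    ultimately show "(x, t) \<in> (\<Union>ij\<in>{1..N} \<times> {1..M}. ?U ij)" by (intro UN_I[of "(i, j)"]) auto
  qed
qed

lemma interpolant_left:
  assumes g: "bilinear_interpolant X tau N M W g" and "t \<in> {0..T}"
  shows "g 0 t = 0"
proof -
  obtain j where j: "j \<in> {1..M}" "t \<in> {tau (j - 1)..tau j}" by (rule t_cell[OF assms(2)])
  have i: "1 \<in> {1..N}" using N_pos by simp
  obtain c0 c1 c2 c3 where
    c: "\<forall>x\<in>{X (1 - 1)..X 1}. \<forall>t\<in>{tau (j - 1)..tau j}. g x t = c0 + c1 * x + c2 * t + c3 * x * t"
    by (rule interpolant_cell[OF g i j(1)])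
  have c': "g 0 t = c0 + c2 * t" if "t \<in> {tau (j - 1)..tau j}" for t
    using bspec[OF bspec[OF c, of 0] that] X_0 X_less[OF i] by simp
  have "g 0 (tau j') = 0" if "j' \<le> M" for j'
  proof -
    have "g (X 0) (tau j') = W 0 j'" using g that unfolding bilinear_interpolant_def by auto
    then show ?thesis using W_left[OF that] X_0 by simp
  qed
  then have z: "c0 + c2 * tau (j - 1) = 0" "c0 + c2 * tau j = 0"
    using c'[of "tau j"] c'[of "tau (j - 1)"] j tau_diff[of j] k_pos by auto
  then have "c2 * (tau j - tau (j - 1)) = 0" unfolding right_diff_distrib by linarith
  then have "c2 = 0" using tau_diff[of j] j k_pos by simp
  then show ?thesis using z c'[OF j(2)] by simp
qed

lemma slope_bound_nonneg: "0 \<le> slope_bound L T \<alpha> A K"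
proof -
  have "0 \<le> DttW_bound L T \<alpha> A K" using DttW_le[of 0 1] M_pos by force
  then show ?thesis
    using DtW_bound_nonneg A_nonneg K_nonneg alpha_pos by (simp add: slope_bound_def)
qed

text \<open>
  Subtracting the scheme at the upper right node \<open>(x\<^sub>i, t\<^sub>j)\<close> of the cell leaves the change of the
  derivatives of the interpolant across the cell, which is governed by \<open>D\<^sub>xD\<^sub>tW\<close>, the change of the
  speed times \<open>D\<^sub>xW\<close>, and the change of the source. As the weight is decreasing, its value at
  \<open>x\<^sub>i\<close> is at most that at \<open>x\<close>.
\<close>

lemma interpolant_residual:
  assumes g: "bilinear_interpolant X tau N M W g"
    and i: "i \<in> {1..N}" and x: "X (i - 1) < x" "x \<le> X i" and t: "t \<in> {0..T}"
    and H: "X i - X (i - 1) \<le> H"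
  shows "\<exists>p q. ((\<lambda>y. g y t) has_real_derivative p) (at_left x) \<and>
    (if t = 0 then q = 0 else ((\<lambda>s. g x s) has_real_derivative q) (at_left t)) \<and>
    \<bar>q + a x t * p - f x\<bar>
      \<le> (H + k) * (1 + 2 * A) * slope_bound L T \<alpha> A K * (1 + layer_weight \<epsilon> x) + \<bar>f x - f (X i)\<bar>"
proof -
  obtain j where j: "j \<in> {1..M}" and tj: "t \<in> {tau (j - 1)..tau j}"
    and t_left: "t \<noteq> 0 \<longrightarrow> tau (j - 1) < t" and t0: "t = 0 \<longrightarrow> j = 1"
    by (rule t_cell[OF t])
  obtain c0 c1 c2 c3 where
    c: "\<forall>x\<in>{X (i - 1)..X i}. \<forall>t\<in>{tau (j - 1)..tau j}. g x t = c0 + c1 * x + c2 * t + c3 * x * t"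
    and P: "DxW i j = c1 + c3 * tau j" "DxW i (j - 1) = c1 + c3 * tau (j - 1)"
    and Z: "DtW i j = c2 + c3 * X i" and V: "DxtW i j = c3"
    by (rule interpolant_cell[OF g i j])
  have "i - 1 \<le> N" "i \<le> N" using i by auto
  then have xL: "x \<in> {0..L}" "X i \<in> {0..L}" using x X_in[of "i - 1"] X_in[of i] by auto
  define C where "C = slope_bound L T \<alpha> A K * (1 + layer_weight \<epsilon> x)"
  have C: "slope_bound L T \<alpha> A K * (1 + layer_weight \<epsilon> (X i)) \<le> C"
    unfolding C_def using layer_weight_antimono[OF eps_pos, of x "X i"] x xL slope_bound_nonneg
    by (intro mult_left_mono) auto
  have c3: "\<bar>c3\<bar> \<le> C" using slopes_le(2)[OF i j] C V by linarith
  have DxW_C: "\<bar>DxW i j'\<bar> \<le> C" if "j' \<le> M" for j' using slopes_le(1)[OF i that] C by linarith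
  have C0: "0 \<le> C" using c3 by linarith
  have a_diff: "\<bar>a x t - a (X i) s\<bar> * \<bar>DxW i j'\<bar> \<le> A * (H + k) * C"
    if "j' \<le> M" "s \<in> {0..T}" "\<bar>t - s\<bar> \<le> k" for s j'
  proof (rule mult_mono[OF _ DxW_C[OF that(1)]])
    have "\<bar>a x t - a (X i) s\<bar> \<le> A * (\<bar>x - X i\<bar> + \<bar>t - s\<bar>)" using a_lip xL t that(2) by blast
    also have "\<dots> \<le> A * (H + k)" using A_nonneg H x that(3) by (intro mult_left_mono add_mono) auto
    finally show "\<bar>a x t - a (X i) s\<bar> \<le> A * (H + k)" .
  qed (use A_nonneg H x k_pos in auto)
  have dx: "((\<lambda>y. g y t) has_real_derivative c1 + c3 * t) (at_left x)"
  proof -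
    have "((\<lambda>y. c0 + c1 * y + c2 * t + c3 * y * t) has_real_derivative c1 + c3 * t)
        (at x within {X (i - 1)..x})"
      by (auto intro!: derivative_eq_intros)
    then have "((\<lambda>y. g y t) has_real_derivative c1 + c3 * t) (at x within {X (i - 1)..x})"
      by (rule has_field_derivative_transform_within[OF _ zero_less_one])
        (use x tj in \<open>auto simp: c\<close>)
    then show ?thesis using x(1) by (simp add: at_within_Icc_at_left)
  qed
  show ?thesis
  proof (cases "t = 0")
    case True
    then have j1: "j = 1" using t0 by simp
    have P0: "DxW i 0 = c1 + c3 * t" using P(2) True j1 by (simp add: tau_eq)
    \<comment> \<open>On the initial line the discrete initial condition replaces the scheme.\<close>
    have "a x t * DxW i 0 - f x = (a x t - a (X i) 0) * DxW i 0 + (f (X i) - f x)"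
      using scheme_eq[OF i, of 0] by (simp add: Dt_0 tau_eq algebra_simps)
    then have "\<bar>0 + a x t * DxW i 0 - f x\<bar>
        \<le> \<bar>a x t - a (X i) 0\<bar> * \<bar>DxW i 0\<bar> + \<bar>f x - f (X i)\<bar>"
      unfolding abs_mult[symmetric] by linarith
    also have "\<dots> \<le> A * (H + k) * C + \<bar>f x - f (X i)\<bar>"
      using a_diff[of 0 0] True k_pos T_pos by auto
    also have "\<dots> \<le> (H + k) * (1 + 2 * A) * C + \<bar>f x - f (X i)\<bar>"
    proof -
      have "0 \<le> (1 + A) * ((H + k) * C)" using A_nonneg H x k_pos C0 by auto
      then show ?thesis by (simp add: algebra_simps)
    qed
    finally show ?thesis using dx True P0 by (auto simp: C_def mult.assoc)
  next
    case False
    have dt: "((\<lambda>s. g x s) has_real_derivative c2 + c3 * x) (at_left t)"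
    proof -
      have "((\<lambda>s. c0 + c1 * x + c2 * s + c3 * x * s) has_real_derivative c2 + c3 * x)
          (at t within {tau (j - 1)..t})"
        by (auto intro!: derivative_eq_intros)
      then have "((\<lambda>s. g x s) has_real_derivative c2 + c3 * x) (at t within {tau (j - 1)..t})"
        by (rule has_field_derivative_transform_within[OF _ zero_less_one])
          (use x tj in \<open>auto simp: c\<close>)
      then show ?thesis using t_left False by (simp add: at_within_Icc_at_left)
    qed
    have jM: "j \<le> M" and tk: "\<bar>t - tau j\<bar> \<le> k" "tau j \<in> {0..T}"
      using j tj tau_diff[of j] tau_in[of j] by auto
    \<comment> \<open>The derivatives of the interpolant, expanded around the upper right node of the cell.\<close>
    have "c2 + c3 * x + a x t * (c1 + c3 * t) - f x
        = c3 * (x - X i) + (a x t * c3) * (t - tau j) + (a x t - co i j) * DxW i j + (f (X i) - f x)"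
      using scheme_eq[OF i jM] unfolding P Z by (simp add: algebra_simps)
    then have "\<bar>c2 + c3 * x + a x t * (c1 + c3 * t) - f x\<bar>
        \<le> \<bar>c3\<bar> * \<bar>x - X i\<bar> + \<bar>a x t\<bar> * \<bar>c3\<bar> * \<bar>t - tau j\<bar>
          + \<bar>a x t - co i j\<bar> * \<bar>DxW i j\<bar> + \<bar>f x - f (X i)\<bar>"
      unfolding abs_mult[symmetric] by linarith
    also have "\<dots> \<le> C * (H + k) + A * C * (H + k) + A * (H + k) * C + \<bar>f x - f (X i)\<bar>"
    proof (intro add_mono order_refl)
      show "\<bar>c3\<bar> * \<bar>x - X i\<bar> \<le> C * (H + k)"
        using c3 C0 H x k_pos by (intro mult_mono) auto
      have "\<bar>a x t\<bar> \<le> A" using a_le[OF xL(1) t] a_ge[OF xL(1) t] alpha_pos by simp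
      then show "\<bar>a x t\<bar> * \<bar>c3\<bar> * \<bar>t - tau j\<bar> \<le> A * C * (H + k)"
        using c3 C0 H x tk A_nonneg by (intro mult_mono) auto
      show "\<bar>a x t - co i j\<bar> * \<bar>DxW i j\<bar> \<le> A * (H + k) * C"
        using a_diff[OF jM tk(2,1)] .
    qed
    also have "\<dots> = (H + k) * (1 + 2 * A) * C + \<bar>f x - f (X i)\<bar>"
      by (simp add: algebra_simps)
    finally show ?thesis using dx dt False by (auto simp: C_def mult.assoc)
  qed
qed

text \<open>
  Up to the point \<open>s\<close> the mesh resolves the scale \<open>\<epsilon>\<close> and the mean value inequality is efficient. Behind
  \<open>s\<close> the two values are estimated separately, and the smallness has to come from the mass of the
  weight beyond \<open>s\<close>.
\<close>

lemma source_variation: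
  assumes f': "\<And>x. x \<in> {0..L} \<Longrightarrow> (f has_real_derivative f' x) (at x within {0..L})"
    and f'_bound: "\<And>x. x \<in> {0..L} \<Longrightarrow> \<bar>f' x\<bar> \<le> K / \<epsilon> * layer_weight \<epsilon> x"
    and i: "i \<in> {1..N}" and x: "X (i - 1) < x" "x \<le> X i" and "0 \<le> \<eta>"
    and fine: "X (i - 1) < s \<Longrightarrow> X i - X (i - 1) \<le> \<epsilon> * \<eta>"
  shows "\<bar>f x - f (X i)\<bar>
    \<le> K * \<eta> * layer_weight \<epsilon> x + (if s < x then 2 * K * layer_weight \<epsilon> x else 0)"
proof -
  have "i - 1 \<le> N" "i \<le> N" using i by auto
  then have xL: "x \<in> {0..L}" "X i \<in> {0..L}" using x X_in[of "i - 1"] X_in[of i] by auto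
  have w0: "0 \<le> layer_weight \<epsilon> x" using layer_weight_nonneg eps_pos xL by simp
  have w: "layer_weight \<epsilon> y \<le> layer_weight \<epsilon> x" if "x \<le> y" for y
    using layer_weight_antimono[OF eps_pos, of x y] xL that by simp
  show ?thesis
  proof (cases "s < x")
    case True
    have "\<bar>f x - f (X i)\<bar> \<le> K * layer_weight \<epsilon> x + K * layer_weight \<epsilon> x"
      using f_le_weight[OF xL(1)] f_le_weight[OF xL(2)] mult_left_mono[OF w[OF x(2)] K_nonneg] by linarith
    moreover have "0 \<le> K * \<eta> * layer_weight \<epsilon> x" using K_nonneg \<open>0 \<le> \<eta>\<close> w0 by simp
    ultimately show ?thesis using True by simp
  next
    case False
    have KE: "0 \<le> K / \<epsilon>" using K_nonneg eps_pos by simp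
    have "norm (f x - f (X i)) \<le> K / \<epsilon> * layer_weight \<epsilon> x * norm (x - X i)"
    proof (rule field_differentiable_bound[where S = "{x..X i}" and f' = f'])
      fix y assume y: "y \<in> {x..X i}"
      then have yL: "y \<in> {0..L}" using xL by auto
      show "(f has_real_derivative f' y) (at y within {x..X i})"
        using f'[OF yL] xL by (auto intro: DERIV_subset)
      show "norm (f' y) \<le> K / \<epsilon> * layer_weight \<epsilon> x"
        using f'_bound[OF yL] mult_left_mono[OF w[of y] KE] y by auto
    qed (use x in auto)
    also have "\<dots> \<le> K / \<epsilon> * layer_weight \<epsilon> x * (\<epsilon> * \<eta>)"
      using fine x False mult_nonneg_nonneg[OF KE w0] by (intro mult_left_mono) auto
    also have "\<dots> = K * \<eta> * layer_weight \<epsilon> x" using eps_pos by simp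
    finally show ?thesis using False by simp
  qed
qed

text \<open>
  The error bound on a general mesh, with a free separation point \<open>s\<close> up to which the mesh width
  is at most \<open>\<epsilon> \<eta>\<close>. The barrier is the integral over \<open>[0,x]\<close> of the residual bound divided by \<open>\<alpha>\<close>; its
  last term accounts for the unresolved tail of the source.
\<close>

lemma error_estimate:
  assumes sol: "layer_solution L T a f w" and g: "bilinear_interpolant X tau N M W g"
    and f': "\<And>x. x \<in> {0..L} \<Longrightarrow> (f has_real_derivative f' x) (at x within {0..L})"
    and f'_bound: "\<And>x. x \<in> {0..L} \<Longrightarrow> \<bar>f' x\<bar> \<le> K / \<epsilon> * layer_weight \<epsilon> x"
    and H: "\<And>i. i \<in> {1..N} \<Longrightarrow> X i - X (i - 1) \<le> H"
    and "0 \<le> \<eta>" "0 \<le> s"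
    and fine: "\<And>i. i \<in> {1..N} \<Longrightarrow> X (i - 1) < s \<Longrightarrow> X i - X (i - 1) \<le> \<epsilon> * \<eta>"
    and x: "x \<in> {0..L}" and t: "t \<in> {0..T}"
  shows "\<bar>g x t - w x t\<bar> \<le>
    (H + k) * (1 + 2 * A) * slope_bound L T \<alpha> A K / \<alpha> * (L + 6)
      + 6 * K * \<eta> / \<alpha> + 2 * K / \<alpha> * (6 - layer_mass \<epsilon> s)"
proof -
  define D where "D = (H + k) * (1 + 2 * A) * slope_bound L T \<alpha> A K / \<alpha>"
  define b where "b x = D * x + (D + K * \<eta> / \<alpha>) * layer_mass \<epsilon> x
      + 2 * K / \<alpha> * (layer_mass \<epsilon> (max x s) - layer_mass \<epsilon> s)" for x
  \<comment> \<open>The left derivative of the barrier; \<open>\<alpha> b'\<close> is the sum of the bounds for the residual.\<close>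
  define b' where "b' x = D + (D + K * \<eta> / \<alpha>) * layer_weight \<epsilon> x
      + 2 * K / \<alpha> * (if s < x then layer_weight \<epsilon> x else 0)" for x
  have "0 < H" using H[of 1] X_less[of 1] N_pos by auto
  then have D: "0 \<le> D" using k_pos A_nonneg slope_bound_nonneg alpha_pos by (simp add: D_def)
  have mass: "(layer_mass \<epsilon> has_real_derivative layer_weight \<epsilon> y) (at y within S)" for y S
    by (rule layer_mass_deriv[OF eps_pos])
  have b_deriv: "(b has_real_derivative b' y) (at_left y)" for y
    unfolding b_def b'_def
    using alpha_pos by (auto intro!: derivative_eq_intros mass has_real_derivative_at_left_max)
  have mass_cont: "continuous_on S (layer_mass \<epsilon>)" for S
    by (rule DERIV_continuous_on) (rule mass)
  have b_cont: "continuous_on S (\<lambda>z. b (fst z))" for S :: "(real \<times> real) set"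
    unfolding b_def by (intro continuous_intros continuous_on_compose2[OF mass_cont[of UNIV]]) auto
  have w_cont: "continuous_on ({0..L} \<times> {0..T}) (\<lambda>(x, t). w x t)"
    using sol unfolding layer_solution_def One_nat_def by simp
  have a_pos: "0 < a x 0" if "x \<in> {0..L}" for x
    using a_ge[OF that, of 0] alpha_pos T_pos by simp
  have f_cont: "continuous_on {0..L} f"
    by (rule DERIV_continuous_on) (rule f')
  have "\<sigma> * (g x t - w x t) - b x \<le> 0" if \<sigma>: "\<bar>\<sigma>\<bar> = 1" for \<sigma>
  proof (rule transport_comparison[where L = L and T = T and a = a and e = "\<lambda>x t. \<sigma> * (g x t - w x t) - b x"])
    show "continuous_on ({0..L} \<times> {0..T}) (\<lambda>(x, t). \<sigma> * (g x t - w x t) - b x)"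
      using interpolant_continuous[OF g] w_cont b_cont unfolding case_prod_beta
      by (intro continuous_intros) auto
    show "\<sigma> * (g 0 t - w 0 t) - b 0 \<le> 0" if "t \<in> {0..T}" for t
      using interpolant_left[OF g that] sol that \<open>0 \<le> s\<close> 
      by (simp add: layer_solution_def b_def layer_mass_0)
    fix x t assume x: "x \<in> {0<..L}" and t: "t \<in> {0..T}"
    obtain i where i: "i \<in> {1..N}" "X (i - 1) < x" "x \<le> X i"
      by (rule mesh_cell[OF X_0 X_N x])
    obtain p q where p: "((\<lambda>y. g y t) has_real_derivative p) (at_left x)"
      and q: "if t = 0 then q = 0 else ((\<lambda>s. g x s) has_real_derivative q) (at_left t)"
      and pq: "\<bar>q + a x t * p - f x\<bar>
        \<le> (H + k) * (1 + 2 * A) * slope_bound L T \<alpha> A K * (1 + layer_weight \<epsilon> x) + \<bar>f x - f (X i)\<bar>"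
      using interpolant_residual[OF g i t H[OF i(1)]] by blast
    obtain p' q' where p': "((\<lambda>y. w y t) has_real_derivative p') (at_left x)"
      and q': "if t = 0 then q' = 0 else ((\<lambda>s. w x s) has_real_derivative q') (at_left t)"
      and pq': "q' + a x t * p' = f x"
      using layer_solution_left_derivatives[OF sol f_cont a_cont a_pos x t] by blast
    have w0: "0 \<le> layer_weight \<epsilon> x" using layer_weight_nonneg eps_pos x by simp
    have b'0: "0 \<le> b' x"
      using D K_nonneg alpha_pos \<open>0 \<le> \<eta>\<close> w0 by (simp add: b'_def)
    have a: "\<alpha> \<le> a x t" using a_ge[of x t] x t by simp
    have "\<bar>q + a x t * p - f x\<bar> \<le> \<alpha> * b' x"
    proof -
      have "\<alpha> * b' x = (H + k) * (1 + 2 * A) * slope_bound L T \<alpha> A K * (1 + layer_weight \<epsilon> x)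
        + (K * \<eta> * layer_weight \<epsilon> x + (if s < x then 2 * K * layer_weight \<epsilon> x else 0))"
      proof -
        have "\<alpha> * b' x = \<alpha> * D * (1 + layer_weight \<epsilon> x)
          + (K * \<eta> * layer_weight \<epsilon> x + (if s < x then 2 * K * layer_weight \<epsilon> x else 0))"
          using alpha_pos by (simp add: b'_def distrib_left distrib_right)
        moreover have "\<alpha> * D = (H + k) * (1 + 2 * A) * slope_bound L T \<alpha> A K"
          using alpha_pos by (simp add: D_def)
        ultimately show ?thesis by simp
      qed
      moreover have "\<bar>f x - f (X i)\<bar>
          \<le> K * \<eta> * layer_weight \<epsilon> x + (if s < x then 2 * K * layer_weight \<epsilon> x else 0)"
        using f' f'_bound i \<open>0 \<le> \<eta>\<close> fine[OF i(1)] by (rule source_variation)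
      ultimately show ?thesis using pq by linarith
    qed
    also have "\<dots> \<le> a x t * b' x" using a b'0 by (rule mult_right_mono)
    finally have "\<sigma> * (q + a x t * p - f x) \<le> a x t * b' x"
      using \<sigma> abs_ge_self[of "\<sigma> * (q + a x t * p - f x)"] by (simp add: abs_mult)
    then have "\<sigma> * (q - q') + a x t * (\<sigma> * (p - p') - b' x) \<le> 0"
      unfolding pq'[symmetric] by (simp add: algebra_simps)
    moreover have "((\<lambda>y. \<sigma> * (g y t - w y t) - b y) has_real_derivative \<sigma> * (p - p') - b' x) (at_left x)"
      by (auto intro!: derivative_eq_intros p p' b_deriv)
    moreover have "if t = 0 then \<sigma> * (q - q') = 0
      else ((\<lambda>s. \<sigma> * (g x s - w x s) - b x) has_real_derivative \<sigma> * (q - q')) (at_left t)"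
      using q q' by (auto intro!: derivative_eq_intros split: if_splits)
    ultimately show "\<exists>p q. ((\<lambda>y. \<sigma> * (g y t - w y t) - b y) has_real_derivative p) (at_left x) \<and>
        (if t = 0 then q = 0 else ((\<lambda>s. \<sigma> * (g x s - w x s) - b x) has_real_derivative q) (at_left t)) \<and>
        q + a x t * p \<le> 0"
      by (intro exI conjI)
  next
    show "0 < a x t" if "x \<in> {0..L}" "t \<in> {0..T}" for x t
      using a_ge[OF that] alpha_pos by linarith
  qed (use L_pos T_pos x t in auto)
  from this[of 1] this[of "-1"] have "\<bar>g x t - w x t\<bar> \<le> b x" by auto
  also have "b x \<le> D * L + (D + K * \<eta> / \<alpha>) * 6 + 2 * K / \<alpha> * (6 - layer_mass \<epsilon> s)"
    unfolding b_def using x D K_nonneg alpha_pos \<open>0 \<le> \<eta>\<close> \<open>0 \<le> s\<close> layer_mass_le[OF eps_pos]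
    by (intro add_mono mult_left_mono) auto
  also have "\<dots> = D * (L + 6) + 6 * K * \<eta> / \<alpha> + 2 * K / \<alpha> * (6 - layer_mass \<epsilon> s)"
    by (simp add: algebra_simps)
  finally show ?thesis by (simp add: D_def)
qed

end

section \<open>The Shishkin mesh\<close>

lemma transition_point_bounds:
  assumes "0 < L" "0 < \<epsilon>" "2 \<le> N"
  shows "0 < transition_point L \<epsilon> N" "transition_point L \<epsilon> N \<le> L / 2"
    "transition_point L \<epsilon> N \<le> \<epsilon> * ln (real N)"
  using assms by (auto simp: transition_point_def)

lemma mesh_x_step:
  assumes "i \<in> {1..2 * n}"
  shows "mesh_x L \<epsilon> (2 * n) i - mesh_x L \<epsilon> (2 * n) (i - 1) =
    (if i \<le> n then transition_point L \<epsilon> (2 * n) / real n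
     else (L - transition_point L \<epsilon> (2 * n)) / real n)"
proof -
  have n: "0 < real n" using assms by auto
  have i: "real (i - 1) = real i - 1" using assms by (simp add: of_nat_diff)
  consider "i \<le> n" | "i = Suc n" | "i - 1 > n" using assms by linarith
  then show ?thesis
  proof cases
    case 1
    then show ?thesis using i by (simp add: mesh_x_def Let_def algebra_simps diff_divide_distrib)
  next
    case 2
    then show ?thesis using n by (simp add: mesh_x_def Let_def field_simps)
  next
    case 3
    define \<sigma> d where "\<sigma> = transition_point L \<epsilon> (2 * n)" and "d = (L - \<sigma>) / real n"
    have "\<not> i - 1 \<le> n" "\<not> i \<le> n" using 3 by auto
    then have "mesh_x L \<epsilon> (2 * n) i = \<sigma> + (real i - real n) * d"
      and "mesh_x L \<epsilon> (2 * n) (i - 1) = \<sigma> + (real i - 1 - real n) * d"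
      using i by (simp_all add: mesh_x_def Let_def \<sigma>_def d_def)
    then have "mesh_x L \<epsilon> (2 * n) i - mesh_x L \<epsilon> (2 * n) (i - 1) = d"
      by (simp add: left_diff_distrib)
    then show ?thesis using \<open>\<not> i \<le> n\<close> by (simp add: d_def \<sigma>_def)
  qed
qed

lemma mesh_x_ends:
  assumes "0 < n"
  shows "mesh_x L \<epsilon> (2 * n) 0 = 0" "mesh_x L \<epsilon> (2 * n) (2 * n) = L"
  using assms by (auto simp: mesh_x_def Let_def field_simps)

lemma mesh_x_coarse:
  assumes "n < i" "i \<le> 2 * n" "transition_point L \<epsilon> (2 * n) \<le> L"
  shows "transition_point L \<epsilon> (2 * n) \<le> mesh_x L \<epsilon> (2 * n) (i - 1)"
proof (cases "i - 1 \<le> n")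
  case True
  then have "i - 1 = n" using assms by auto
  then show ?thesis using assms by (simp add: mesh_x_def Let_def)
next
  case False
  then show ?thesis using assms by (auto simp: mesh_x_def Let_def)
qed

section \<open>The error bound\<close>

theorem theorem3:
  fixes L T \<alpha> K :: real
    and a :: "real \<Rightarrow> real \<Rightarrow> real"
    and f :: "real \<Rightarrow> real \<Rightarrow> real"
  assumes "L > 0" and "T > 0"
    and "Ck_rect 3 L T a"
    and "\<alpha> > 0" and "\<And>x t. x \<in> {0..L} \<Longrightarrow> t \<in> {0..T} \<Longrightarrow> a x t \<ge> \<alpha>"
    and "((\<lambda>t. a 0 t) has_real_derivative 0) (at 0 within {0..T})"
    and "\<And>\<epsilon>. 0 < \<epsilon> \<Longrightarrow> \<epsilon> \<le> 1 \<Longrightarrow> layer_source L K \<epsilon> (f \<epsilon>)"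
  shows "\<exists>C :: real. \<forall>\<epsilon> N M w W Wbar.
    0 < \<epsilon> \<longrightarrow> \<epsilon> \<le> 1 \<longrightarrow> 0 < N \<longrightarrow> even N \<longrightarrow> 0 < M \<longrightarrow>
    layer_solution L T a (f \<epsilon>) w \<longrightarrow>
    upwind_solution (mesh_x L \<epsilon> N) (mesh_t T M) N M a (f \<epsilon>) W \<longrightarrow>
    bilinear_interpolant (mesh_x L \<epsilon> N) (mesh_t T M) N M W Wbar \<longrightarrow>
    linf_norm L T (\<lambda>x t. Wbar x t - w x t) \<le> C * (ln (real N))\<^sup>2 / real N + C / real M"
proof -
  obtain A where A: "transport_speed L T \<alpha> A a"
    using transport_speed_exists[OF assms(1-6)] by blast
  have K: "0 \<le> K" by (rule layer_source_bounds[OF assms(7)[of 1] \<open>L > 0\<close>]) auto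
  define E where "E = (1 + 2 * A) * slope_bound L T \<alpha> A K / \<alpha> * (L + 6)"
  define C where "C = (8 * L + T) * \<bar>E\<bar> + 90 * K / \<alpha>"
  show ?thesis
  proof (intro exI[of _ C] allI impI)
    fix \<epsilon> :: real and N M :: nat and w Wbar :: "real \<Rightarrow> real \<Rightarrow> real" and W :: "nat \<Rightarrow> nat \<Rightarrow> real"
    assume eps: "0 < \<epsilon>" "\<epsilon> \<le> 1" and N: "0 < N" "even N" and M: "0 < M"
      and sol: "layer_solution L T a (f \<epsilon>) w"
      and W: "upwind_solution (mesh_x L \<epsilon> N) (mesh_t T M) N M a (f \<epsilon>) W"
      and Wbar: "bilinear_interpolant (mesh_x L \<epsilon> N) (mesh_t T M) N M W Wbar"
    obtain n where n: "N = 2 * n" "0 < n" using N by (auto elim: evenE)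
    define X where "X = mesh_x L \<epsilon> N"
    \<comment> \<open>Beyond \<open>s\<close> the mass of the weight is \<open>1/N\<close> up to powers of \<open>ln N\<close>. If the mesh is uniform,
      \<open>s\<close> may lie behind the transition point \<open>L/2\<close>; every cell is fine in that case.\<close>
    define s where "s = \<epsilon> * ln (real N)"
    define l where "l = ln (real N)"
    define \<sigma> where "\<sigma> = transition_point L \<epsilon> N"
    have \<sigma>: "0 < \<sigma>" "\<sigma> \<le> L / 2" "\<sigma> \<le> s"
      using transition_point_bounds[OF \<open>L > 0\<close> eps(1), of N] n by (auto simp: \<sigma>_def s_def)
    have step: "X i - X (i - 1) = (if i \<le> n then \<sigma> / real n else (L - \<sigma>) / real n)"
      if "i \<in> {1..N}" for i
      using mesh_x_step[of i n] that by (simp add: X_def \<sigma>_def n)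
    obtain f' where "0 \<le> K"
      and f_bound: "\<forall>x\<in>{0..L}. \<bar>f \<epsilon> x\<bar> \<le> K * (x\<^sup>2 / \<epsilon> ^ 3 * exp (- (x / \<epsilon>)))"
      and f': "\<forall>x\<in>{0..L}. (f \<epsilon> has_real_derivative f' x) (at x within {0..L})"
        "\<forall>x\<in>{0..L}. \<bar>f' x\<bar> \<le> K / \<epsilon> * layer_weight \<epsilon> x"
      by (rule layer_source_bounds[OF assms(7)[OF eps] \<open>L > 0\<close> eps])
    have X_less: "X (i - 1) < X i" if "i \<in> {1..N}" for i
    proof -
      have "0 < X i - X (i - 1)" unfolding step[OF that] using \<sigma> n \<open>L > 0\<close> by auto
      then show ?thesis by simp
    qed
    interpret transport_speed L T \<alpha> A a by (rule A)
    interpret upwind_layer L T \<alpha> A a K \<epsilon> "f \<epsilon>" N M X W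
    proof
      show "X 0 = 0" "X N = L" using mesh_x_ends[OF n(2)] by (simp_all add: X_def n)
      show "upwind_solution X (mesh_t T M) N M a (f \<epsilon>) W" using W by (simp add: X_def)
    qed (use eps K f_bound X_less M in auto)
    have H: "X i - X (i - 1) \<le> L / real n" if "i \<in> {1..N}" for i
      unfolding step[OF that] using \<sigma> n by (auto intro: divide_right_mono)
    have fine: "X i - X (i - 1) \<le> \<epsilon> * (l / real n)" if "i \<in> {1..N}" "X (i - 1) < s" for i
    proof -
      have "X i - X (i - 1) \<le> s / real n"
      proof (cases "i \<le> n")
        case True
        then show ?thesis unfolding step[OF that(1)] using \<sigma> by (simp add: divide_right_mono)
      next
        case False
        then have "\<sigma> \<le> X (i - 1)"
          using mesh_x_coarse[of n i L \<epsilon>] that \<sigma> \<open>L > 0\<close> by (auto simp: X_def \<sigma>_def n)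
        \<comment> \<open>A coarse cell starting before \<open>s\<close> occurs only if the minimum in the transition point is \<open>L/2\<close>.\<close>
        with that(2) have "\<sigma> = L / 2" by (auto simp: \<sigma>_def s_def transition_point_def)
        then show ?thesis unfolding step[OF that(1)] using False \<sigma> by (simp add: divide_right_mono)
      qed
      then show ?thesis by (simp add: s_def l_def)
    qed
    \<comment> \<open>As \<open>N \<ge> 2\<close>, lower powers of \<open>ln N\<close> are absorbed into the square.\<close>
    have l_half: "1 / 2 \<le> l"
    proof -
      have "ln 2 \<le> l" unfolding l_def using n by simp
      then show ?thesis using ln2_ge_two_thirds by linarith
    qed
    have l_pow: "1 \<le> 4 * l\<^sup>2" "l \<le> 2 * l\<^sup>2"
      using power_mono[OF l_half, of 2] mult_right_mono[OF l_half, of l] l_half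
      by (auto simp: power2_eq_square)
    have E_nonneg: "0 \<le> E"
      unfolding E_def using slope_bound_nonneg A_nonneg alpha_pos L_pos by simp
    have tail: "6 - layer_mass \<epsilon> s = (l\<^sup>2 + 4 * l + 6) / real N"
    proof -
      have "s / \<epsilon> = l" "exp (- l) = 1 / real N"
        using eps N by (simp_all add: s_def l_def exp_minus divide_inverse)
      then show ?thesis by (simp add: layer_mass_def)
    qed
    have "linf_norm L T (\<lambda>x t. Wbar x t - w x t)
      \<le> (L / real n + k) * (1 + 2 * A) * slope_bound L T \<alpha> A K / \<alpha> * (L + 6)
        + 6 * K * (l / real n) / \<alpha> + 2 * K / \<alpha> * (6 - layer_mass \<epsilon> s)"
      unfolding linf_norm_def
    proof (rule cSUP_least)
      show "{0..L} \<times> {0..T} \<noteq> {}" using \<open>L > 0\<close> \<open>T > 0\<close> by auto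
      fix z assume "z \<in> {0..L} \<times> {0..T}"
      then obtain x t where z: "z = (x, t)" and xt: "x \<in> {0..L}" "t \<in> {0..T}" by auto
      have "\<bar>Wbar x t - w x t\<bar>
        \<le> (L / real n + k) * (1 + 2 * A) * slope_bound L T \<alpha> A K / \<alpha> * (L + 6)
        + 6 * K * (l / real n) / \<alpha> + 2 * K / \<alpha> * (6 - layer_mass \<epsilon> s)"
      proof (rule error_estimate[where g = Wbar and w = w and x = x and t = t and f' = f' and H = "L / real n" and \<eta> = "l / real n" and s = s])
        show "bilinear_interpolant X (mesh_t T M) N M W Wbar" using Wbar by (simp add: X_def)
        show "0 \<le> l / real n" "0 \<le> s" using l_half eps by (auto simp: s_def l_def)
      qed (use sol f' H fine xt in auto)
      then show "(case z of (x, t) \<Rightarrow> \<bar>Wbar x t - w x t\<bar>)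
        \<le> (L / real n + k) * (1 + 2 * A) * slope_bound L T \<alpha> A K / \<alpha> * (L + 6)
        + 6 * K * (l / real n) / \<alpha> + 2 * K / \<alpha> * (6 - layer_mass \<epsilon> s)"
        by (simp add: z)
    qed
    also have "\<dots> = (2 * L * (1 / real N) + T / real M) * E + 12 * K / \<alpha> * (l / real N)
        + 2 * K / \<alpha> * ((l\<^sup>2 + 4 * l + 6) / real N)"
      unfolding tail k_def E_def using n by (simp add: mult_ac)
    also have "\<dots> \<le> (2 * L * (4 * l\<^sup>2 / real N) + T / real M) * \<bar>E\<bar> + 12 * K / \<alpha> * (2 * l\<^sup>2 / real N)
        + 2 * K / \<alpha> * (33 * l\<^sup>2 / real N)"
      using K \<open>\<alpha> > 0\<close> \<open>L > 0\<close> \<open>T > 0\<close> l_pow l_half E_nonneg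
      by (intro add_mono mult_mono mult_left_mono divide_right_mono) auto
    also have "\<dots> = (8 * L * \<bar>E\<bar> + 90 * K / \<alpha>) * (l\<^sup>2 / real N) + T * \<bar>E\<bar> * (1 / real M)"
      by (simp add: algebra_simps add_divide_distrib)
    also have "\<dots> \<le> C * (l\<^sup>2 / real N) + C * (1 / real M)"
      using K \<open>\<alpha> > 0\<close> \<open>L > 0\<close> \<open>T > 0\<close>
      by (intro add_mono mult_right_mono) (auto simp: C_def distrib_right)
    finally show "linf_norm L T (\<lambda>x t. Wbar x t - w x t) \<le> C * (ln (real N))\<^sup>2 / real N + C / real M"
      by (simp add: l_def)
  qed
qed

end
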